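(* Let $m \in \{0,1,2,\ldots\} \cup \{\infty\}$. The set $$\{f \in \mathcal{S}^m([0,\infty)) : r(f,\alpha) = \infty \text{ for every } \alpha \in \mathbb{R}\}$$ is dense and $\mathcal{G}_\delta$ in the space $\mathcal{S}^m([0,\infty))$.
   Context: For nonnegative integers $\ell,k$ put $$\rho_{\ell,k}(f) := \sup_{t \geq 0}\left[ t^\ell \left|\frac{\partial^k f(t)}{\partial t^k}\right|\right].$$ For fixed $m = 0,1,2,\ldots,\infty$, $\mathcal{S}^m([0,\infty))$ is the set of complex-valued $f \in C^m([0,\infty))$ (with one-sided derivatives at $0$) such that $\rho_{\ell,k}(f) < \infty$ for all nonnegative integers $\ell$ and $k$ with $k \leq m$. It is a Fréchet space with the topology induced by the seminorms $\rho_{\ell,k}$, $\ell \ge 0$, $k \leq m$ ($k$ a nonnegative integer). For $f \in \mathcal{S}^m([0,\infty))$ its Fourier-Laplace transform is $\hat{f}(z) = \int_0^\infty e^{-izt} f(t)\,dt$, defined for $z \in \mathbb{C}$ with $\operatorname{Im} z \leq 0$. It is $C^\infty$ on $\{\operatorname{Im} z \leq 0\}$ and holomorphic on $\{\operatorname{Im} z < 0\}$. For $\alpha \in \mathbb{R}$ and $n \in \mathbb{N}=\{1,2,\ldots\}$, $(\hat{f})^{(n)}(\alpha)$ denotes the $n$-th derivative at $x=\alpha$ of the function $x \mapsto \hat f(x)$ of the real variable $x$, i.e. $(\hat{f})^{(n)}(\alpha)=\int_0^\infty e^{-i\alpha t}(-it)^n f(t)\,dt$. Set $$r(f,\alpha)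 := \limsup_{n \to \infty} \sqrt[n]{\frac{|(\hat{f})^{(n)}(\alpha)|}{n!}}.$$ *)

theory Defs
  imports "HOL-Analysis.Analysis"
begin

text \<open>Iterated derivative relative to a set: \<open>S = {0..}\<close> gives derivatives on the half-line
  that are one-sided at \<open>0\<close>, \<open>S = UNIV\<close> the ordinary ones.\<close>

definition iter_deriv :: "real set \<Rightarrow> nat \<Rightarrow> (real \<Rightarrow> complex) \<Rightarrow> real \<Rightarrow> complex" where
  "iter_deriv S k = (\<lambda>f t. vector_derivative f (at t within S)) ^^ k"

definition C_half_line :: "enat \<Rightarrow> (real \<Rightarrow> complex) \<Rightarrow> bool" where
  "C_half_line m f \<longleftrightarrow>
     (\<forall>k. enat k < m \<longrightarrow> iter_deriv {0..} k f differentiable_on {0..}) \<and>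
     (\<forall>k. enat k \<le> m \<longrightarrow> continuous_on {0..} (iter_deriv {0..} k f))"

definition rho :: "nat \<Rightarrow> nat \<Rightarrow> (real \<Rightarrow> complex) \<Rightarrow> ereal" where
  "rho l k f = (SUP t\<in>{0..}. ereal (t ^ l * norm (iter_deriv {0..} k f t)))"

text \<open>A function on \<open>[0,\<infinity>)\<close> is represented by a total function taking the value
  \<open>undefined\<close> at negative arguments, so that functions agreeing on \<open>[0,\<infinity>)\<close> are equal.\<close>

definition schwartz_half_line :: "enat \<Rightarrow> (real \<Rightarrow> complex) set" where
  "schwartz_half_line m =
     {f \<in> extensional {0..}. C_half_line m f \<and> (\<forall>l k. enat k \<le> m \<longrightarrow> rho l k f < \<infinity>)}"

text \<open>The topology induced by the seminorms, with all seminorm balls as a subbase. Note that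
  \<^term>\<open>rho\<close> only sees the values of \<open>g - f\<close> on \<open>[0,\<infinity>)\<close>.\<close>

definition schwartz_topology :: "enat \<Rightarrow> (real \<Rightarrow> complex) topology" where
  "schwartz_topology m = topology_generated_by
     {{g \<in> schwartz_half_line m. rho l k (\<lambda>t. g t - f t) < ereal e} | f l k e.
        f \<in> schwartz_half_line m \<and> enat k \<le> m \<and> 0 < e}"

text \<open>Intended for \<open>Im z \<le> 0\<close>; elsewhere the Lebesgue integral may fail to exist and is then
  \<open>0\<close> by convention.\<close>

definition fourier_laplace :: "(real \<Rightarrow> complex) \<Rightarrow> complex \<Rightarrow> complex" where
  "fourier_laplace f z = (LINT t:{0..}|lborel. exp (- \<i> * z * of_real t) * f t)"

definition fl_deriv :: "nat \<Rightarrow> (real \<Rightarrow> complex) \<Rightarrow> real \<Rightarrow> complex" where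
  "fl_deriv n f \<alpha> = iter_deriv UNIV n (\<lambda>x. fourier_laplace f (of_real x)) \<alpha>"

text \<open>The term for \<open>n = 0\<close>, where \<^term>\<open>root 0 x\<close> is \<open>0\<close>, does not affect the limit superior.\<close>

definition r_inv :: "(real \<Rightarrow> complex) \<Rightarrow> real \<Rightarrow> ereal" where
  "r_inv f \<alpha> = limsup (\<lambda>n. ereal (root n (norm (fl_deriv n f \<alpha>) / fact n)))"

lemma iter_deriv_0 [simp]: "iter_deriv S 0 f = f"
  by (simp add: iter_deriv_def)

lemma iter_deriv_Suc:
  "iter_deriv S (Suc k) f t = vector_derivative (iter_deriv S k f) (at t within S)"
  by (simp add: iter_deriv_def)

lemma topspace_schwartz_topology: "topspace (schwartz_topology m) = schwartz_half_line m"
proof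
  show "topspace (schwartz_topology m) \<subseteq> schwartz_half_line m"
    unfolding schwartz_topology_def topology_generated_by_topspace by blast
next
  show "schwartz_half_line m \<subseteq> topspace (schwartz_topology m)"
  proof
    fix f assume f: "f \<in> schwartz_half_line m"
    let ?B = "{g \<in> schwartz_half_line m. rho 0 0 (\<lambda>t. g t - f t) < ereal 1}"
    have m: "enat 0 \<le> m"
      by (simp flip: zero_enat_def)
    have "rho 0 0 (\<lambda>t. f t - f t) < ereal 1"
      by (simp add: rho_def)
    then have "f \<in> ?B"
      using f by blast
    moreover have "\<exists>h l k e. ?B = {g \<in> schwartz_half_line m. rho l k (\<lambda>t. g t - h t) < ereal e}
        \<and> h \<in> schwartz_half_line m \<and> enat k \<le> m \<and> 0 < e"
      by (rule exI[of _ f], rule exI[of _ 0], rule exI[of _ 0], rule exI[of _ 1]) (use f m in simp)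
    ultimately show "f \<in> topspace (schwartz_topology m)"
      unfolding schwartz_topology_def topology_generated_by_topspace by (intro UnionI CollectI)
  qed
qed

end

theory Submission
  imports Defs "HOL-Probability.Sinc_Integral" "HOL-Probability.Characteristic_Functions"
begin

text \<open>The set in question is the intersection over \<open>M \<in> \<nat>\<close> of the sets of all \<open>f\<close> such that for every
  \<open>\<alpha> \<in> [-M, M]\<close> some derivative of order \<open>n > M\<close> of the transform exceeds \<open>M\<^sup>n n!\<close> at \<open>\<alpha>\<close>. These are
  open, because \<open>[-M, M]\<close> is compact and the derivatives depend continuously on \<open>(f, \<alpha>)\<close>.

  Density is shown by construction rather than by Baire's theorem. Given \<open>f\<close>, there is a Schwartz
  function \<open>h\<close> with \<open>f + \<epsilon>h\<close> in the set for every \<open>\<epsilon> > 0\<close>: take \<open>h\<close> as the sum of bumps of height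
  \<open>T\<^sub>i\<close> to the power \<open>-(4i+3)\<close> supported in \<open>[T\<^sub>i, T\<^sub>i + 1/(i+1)]\<close>. For \<open>\<bar>\<alpha>\<bar> \<le> i+1\<close> the exponential hardly
  oscillates on the \<open>i\<close>-th bump, so that this bump contributes a multiple of \<open>T\<^sub>i\<close> to the derivative of
  order \<open>4i+4\<close> at \<open>\<alpha>\<close>, while the contributions of the other bumps and of \<open>f\<close> are bounded in terms of
  \<open>f\<close>, \<open>i\<close> and \<open>T\<^sub>0, \<dots>, T\<^sub>i\<^sub>-\<^sub>1\<close>. Hence it suffices that \<open>T\<^sub>i\<close> grows fast enough.\<close>

subsection \<open>Derivatives of the transform as moments\<close>

text \<open>Comparison with \<open>B / (1 + t^2)\<close>, whose integral over the whole line is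
  \<open>B * pi\<close>; the factor 2 lost by not restricting to the half-line is harmless.\<close>

lemma integral_half_line_bound:
  fixes u :: "real \<Rightarrow> complex"
  assumes u: "continuous_on {0..} u" and B: "\<And>t. t \<ge> 0 \<Longrightarrow> (1 + t\<^sup>2) * norm (u t) \<le> B"
  shows "set_integrable lborel {0..} u" "norm (LINT t:{0..}|lborel. u t) \<le> B * pi"
proof -
  have w: "set_integrable lborel UNIV (\<lambda>x::real. inverse (1 + x\<^sup>2))"
    using integrable_inverse_1_plus_square by simp
  have w_int: "(LINT x:UNIV|lborel. inverse (1 + x\<^sup>2 :: real)) = pi"
    using LBINT_inverse_1_plus_square by (simp add: interval_lebesgue_integral_def)
  have "B \<ge> 0"
    using B[of 0] by (simp add: order.trans[OF norm_ge_zero])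
  have wB: "set_integrable lborel {0..} (\<lambda>x::real. B * inverse (1 + x\<^sup>2))"
    using set_integrable_subset[OF w, of "{0..}"] by simp
  have le: "norm (u t) \<le> B * inverse (1 + t\<^sup>2)" if "t \<ge> 0" for t
    using B[OF that] by (simp add: field_simps add_pos_nonneg)
  show int: "set_integrable lborel {0..} u"
  proof (rule set_integrable_bound[OF wB])
    show "set_borel_measurable lborel {0..} u"
      using set_measurable_continuous_on[of "{0..}" u] u by (simp add: set_borel_measurable_def)
    show "AE x in lborel. x \<in> {0..} \<longrightarrow> norm (u x) \<le> norm (B * inverse (1 + x\<^sup>2))"
      using le \<open>B \<ge> 0\<close> by (intro AE_I2) (simp add: abs_mult)
  qed
  have "norm (LINT t:{0..}|lborel. u t) \<le> (LINT t|lborel. norm (indicator {0..} t *\<^sub>R u t))"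
    unfolding set_lebesgue_integral_def by (rule integral_norm_bound)
  also have "\<dots> \<le> (LINT t|lborel. B * (indicator UNIV t *\<^sub>R inverse (1 + t\<^sup>2)))"
  proof (rule integral_mono)
    show "integrable lborel (\<lambda>t. norm (indicator {0..} t *\<^sub>R u t))"
      using int unfolding set_integrable_def by (rule integrable_norm)
    show "integrable lborel (\<lambda>t. B * (indicator UNIV t *\<^sub>R inverse (1 + t\<^sup>2)))"
      using w by (simp add: set_integrable_def)
    show "norm (indicator {0..} t *\<^sub>R u t) \<le> B * (indicator UNIV t *\<^sub>R inverse (1 + t\<^sup>2))" for t
      using le[of t] \<open>B \<ge> 0\<close> by (auto simp: indicator_def)
  qed
  also have "\<dots> = B * pi"
    using w_int by (simp add: set_lebesgue_integral_def)
  finally show "norm (LINT t:{0..}|lborel. u t) \<le> B * pi" .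
qed

text \<open>The part of membership in \<open>schwartz_half_line m\<close> that the transform sees:
  only the seminorms of order \<open>k = 0\<close>, no dependence on \<open>m\<close>, and no
  convention at negative arguments. It therefore also applies to sums and differences that are not
  restricted to the half-line.\<close>

definition rapidly_decreasing :: "(real \<Rightarrow> complex) \<Rightarrow> bool" where
  "rapidly_decreasing f \<longleftrightarrow>
     continuous_on {0..} f \<and> (\<forall>l. \<exists>B. \<forall>t\<ge>0. t ^ l * norm (f t) \<le> B)"

text \<open>The differentiated integrand, integrated. All estimates are made for this integral,
  which \<open>fl_deriv_eq_fl_moment\<close> identifies with the iterated derivative.\<close>

definition fl_moment :: "nat \<Rightarrow> (real \<Rightarrow> complex) \<Rightarrow> real \<Rightarrow> complex" where
  "fl_moment n f \<alpha> = (LINT t:{0..}|lborel. (- \<i> * of_real t) ^ n * exp (- \<i> * of_real \<alpha> * of_real t) * f t)"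

lemma norm_fl_kernel [simp]:
  "norm ((- \<i> * of_real t) ^ n * exp (- \<i> * of_real \<alpha> * of_real t)) = \<bar>t\<bar> ^ n"
  by (simp add: norm_mult norm_power)

lemma continuous_on_fl_kernel:
  "continuous_on {0..} f \<Longrightarrow>
     continuous_on {0..} (\<lambda>t. (- \<i> * of_real t) ^ n * exp (- \<i> * of_real \<alpha> * of_real t) * f t)"
  by (intro continuous_intros)

lemma weighted_bound:
  assumes "rapidly_decreasing f"
  obtains B where "\<And>t. t \<ge> 0 \<Longrightarrow> (1 + t\<^sup>2) * (t ^ n * norm (f t)) \<le> B"
proof -
  obtain B C where "\<forall>t\<ge>0. t ^ n * norm (f t) \<le> B" "\<forall>t\<ge>0. t ^ (n + 2) * norm (f t) \<le> C"
    using assms unfolding rapidly_decreasing_def by meson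
  then show ?thesis
    by (intro that[of "B + C"])
      (simp add: algebra_simps power2_eq_square add_mono)
qed

text \<open>On the half-line the kernel has modulus \<open>t ^ n\<close>, whatever \<alpha> is. The
  bound is therefore uniform in \<alpha>, which openness and density both rely on.\<close>

lemma
  assumes f: "rapidly_decreasing f"
  shows fl_moment_integrable:
      "set_integrable lborel {0..} (\<lambda>t. (- \<i> * of_real t) ^ n * exp (- \<i> * of_real \<alpha> * of_real t) * f t)"
    and fl_moment_le:
      "(\<And>t. t \<ge> 0 \<Longrightarrow> (1 + t\<^sup>2) * (t ^ n * norm (f t)) \<le> B) \<Longrightarrow> norm (fl_moment n f \<alpha>) \<le> B * pi"
proof -
  have c: "continuous_on {0..} f"
    using f by (simp add: rapidly_decreasing_def)
  have eq: "norm ((- \<i> * of_real t) ^ n * exp (- \<i> * of_real \<alpha> * of_real t) * f t) = t ^ n * norm (f t)"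
    if "t \<ge> 0" for t
    using that by (subst norm_mult) (simp only: norm_fl_kernel abs_of_nonneg)
  obtain C where "\<And>t. t \<ge> 0 \<Longrightarrow> (1 + t\<^sup>2) * (t ^ n * norm (f t)) \<le> C"
    using weighted_bound[OF f, of n] by metis
  then show "set_integrable lborel {0..} (\<lambda>t. (- \<i> * of_real t) ^ n * exp (- \<i> * of_real \<alpha> * of_real t) * f t)"
    by (intro integral_half_line_bound(1)[OF continuous_on_fl_kernel[OF c]]) (simp only: eq)
  assume "\<And>t. t \<ge> 0 \<Longrightarrow> (1 + t\<^sup>2) * (t ^ n * norm (f t)) \<le> B"
  then show "norm (fl_moment n f \<alpha>) \<le> B * pi"
    unfolding fl_moment_def
    by (intro integral_half_line_bound(2)[OF continuous_on_fl_kernel[OF c]]) (simp only: eq)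
qed

lemma rapidly_decreasing_linear:
  assumes "rapidly_decreasing f" "rapidly_decreasing g"
  shows "rapidly_decreasing (\<lambda>t. a * f t + b * g t)"
  unfolding rapidly_decreasing_def
proof (intro conjI allI)
  show "continuous_on {0..} (\<lambda>t. a * f t + b * g t)"
    using assms by (auto simp: rapidly_decreasing_def intro!: continuous_intros)
  fix l
  obtain B C where *: "\<forall>t\<ge>0. t ^ l * norm (f t) \<le> B" "\<forall>t\<ge>0. t ^ l * norm (g t) \<le> C"
    using assms unfolding rapidly_decreasing_def by meson
  have "t ^ l * norm (a * f t + b * g t) \<le> norm a * B + norm b * C" if "t \<ge> 0" for t
  proof -
    have "t ^ l * norm (a * f t + b * g t) \<le> t ^ l * (norm a * norm (f t) + norm b * norm (g t))"
      using that by (intro mult_left_mono) (auto intro: order.trans[OF norm_triangle_ineq] simp: norm_mult)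
    also have "\<dots> = norm a * (t ^ l * norm (f t)) + norm b * (t ^ l * norm (g t))"
      by (simp add: algebra_simps)
    also have "\<dots> \<le> norm a * B + norm b * C"
      using * that by (intro add_mono mult_left_mono) auto
    finally show ?thesis .
  qed
  then show "\<exists>B. \<forall>t\<ge>0. t ^ l * norm (a * f t + b * g t) \<le> B"
    by blast
qed

lemma fl_moment_linear:
  assumes "rapidly_decreasing f" "rapidly_decreasing g"
  shows "fl_moment n (\<lambda>t. a * f t + b * g t) \<alpha> = a * fl_moment n f \<alpha> + b * fl_moment n g \<alpha>"
proof -
  note int = fl_moment_integrable[OF assms(1)] fl_moment_integrable[OF assms(2)]
  let ?k = "\<lambda>t. (- \<i> * of_real t) ^ n * exp (- \<i> * of_real \<alpha> * of_real t)"
  have "fl_moment n (\<lambda>t. a * f t + b * g t) \<alpha> =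
      (LINT t:{0..}|lborel. a * (?k t * f t) + b * (?k t * g t))"
    unfolding fl_moment_def by (simp add: algebra_simps)
  also have "\<dots> = (LINT t:{0..}|lborel. a * (?k t * f t)) + (LINT t:{0..}|lborel. b * (?k t * g t))"
    using int by (intro set_integral_add(2) set_integrable_mult_right)
  also have "\<dots> = a * fl_moment n f \<alpha> + b * fl_moment n g \<alpha>"
    unfolding fl_moment_def by (simp only: set_integral_mult_right)
  finally show ?thesis .
qed

lemma fl_moment_cong:
  "(\<And>t. t \<ge> 0 \<Longrightarrow> f t = g t) \<Longrightarrow> fl_moment n f \<alpha> = fl_moment n g \<alpha>"
  unfolding fl_moment_def by (intro set_lebesgue_integral_cong) auto

text \<open>A quadratic remainder leaves an error of at most \<open>C * \<bar>y - x\<bar>\<close> in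
  the difference quotient. This serves both for differentiating under the integral sign and for the
  zeros of the bump functions.\<close>

lemma has_vector_derivative_quadratic_bound:
  fixes F :: "real \<Rightarrow> 'a::real_normed_vector"
  assumes "\<And>y. norm (F y - F x - (y - x) *\<^sub>R D) \<le> C * (y - x)\<^sup>2"
  shows "(F has_vector_derivative D) (at x within S)"
proof (rule has_vector_derivative_at_within)
  show "(F has_vector_derivative D) (at x)"
    unfolding has_vector_derivative_def has_derivative_at2
  proof (intro conjI)
    show "bounded_linear (\<lambda>r. r *\<^sub>R D)"
      by (rule bounded_linear_scaleR_left)
    have "((\<lambda>y. C * \<bar>y - x\<bar>) \<longlongrightarrow> C * \<bar>x - x\<bar>) (at x)"
      by (intro tendsto_intros)
    then have "((\<lambda>y. C * \<bar>y - x\<bar>) \<longlongrightarrow> 0) (at x)"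
      by simp
    then show "((\<lambda>y. (1 / norm (y - x)) *\<^sub>R (F y - (F x + (y - x) *\<^sub>R D))) \<longlongrightarrow> 0) (at x)"
    proof (rule Lim_null_comparison[rotated], intro always_eventually allI)
      fix y
      show "norm ((1 / norm (y - x)) *\<^sub>R (F y - (F x + (y - x) *\<^sub>R D))) \<le> C * \<bar>y - x\<bar>"
      proof (cases "y = x")
        case False
        have "norm (F y - (F x + (y - x) *\<^sub>R D)) \<le> C * (\<bar>y - x\<bar> * \<bar>y - x\<bar>)"
          using assms[of y] by (simp add: diff_diff_eq power2_eq_square)
        with False show ?thesis
          by (simp add: pos_divide_le_eq mult.assoc)
      qed simp
    qed
  qed
qed

text \<open>Differentiation under the integral sign by Taylor's formula:
  \<open>exp (\<i> * u)\<close> differs from \<open>1 + \<i> * u\<close> by at most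
  \<open>u^2 / 2\<close>, so the remainder is at most \<open>(y - \<alpha>)^2\<close> times a
  convergent integral with weight \<open>t ^ (n + 2)\<close>.\<close>

lemma fl_moment_has_vector_derivative:
  assumes f: "rapidly_decreasing f"
  shows "(fl_moment n f has_vector_derivative fl_moment (Suc n) f \<alpha>) (at \<alpha> within S)"
proof -
  obtain B where B: "\<And>t. t \<ge> 0 \<Longrightarrow> (1 + t\<^sup>2) * (t ^ (n + 2) * norm (f t)) \<le> B"
    using weighted_bound[OF f, of "n + 2"] by metis
  let ?k = "\<lambda>n x t. (- \<i> * of_real t) ^ n * exp (- \<i> * of_real x * of_real t)"
  show ?thesis
  proof (rule has_vector_derivative_quadratic_bound)
    fix y
    have int: "set_integrable lborel {0..} (\<lambda>t. ?k n x t * f t)" for n x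
      by (rule fl_moment_integrable[OF f])
    define E where "E = (\<lambda>t. ?k n y t * f t - ?k n \<alpha> t * f t - (y - \<alpha>) *\<^sub>R (?k (Suc n) \<alpha> t * f t))"
    have "fl_moment n f y - fl_moment n f \<alpha> - (y - \<alpha>) *\<^sub>R fl_moment (Suc n) f \<alpha> = (LINT t:{0..}|lborel. E t)"
      unfolding fl_moment_def E_def
      by (simp only: set_integral_diff set_integral_scaleR_right set_integrable_scaleR_right int)
    also have "norm \<dots> \<le> ((y - \<alpha>)\<^sup>2 * B) * pi"
    proof (rule integral_half_line_bound(2))
      show "continuous_on {0..} E"
        unfolding E_def using f
        by (intro continuous_intros continuous_on_fl_kernel) (auto simp: rapidly_decreasing_def)
      fix t :: real assume t: "t \<ge> 0"
      \<comment> \<open>The phase change between \<alpha> and \<open>y\<close>: \<open>E t\<close>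
        is the integrand at \<alpha> times the first-order Taylor remainder of
        \<open>exp (\<i> * u)\<close>.\<close>
      define u where "u = - (y - \<alpha>) * t"
      have "E t = ?k n \<alpha> t * f t * (exp (\<i> * of_real u) - (1 + \<i> * of_real u))"
        unfolding E_def u_def by (simp add: algebra_simps scaleR_conv_of_real flip: exp_add)
      also have "norm \<dots> = t ^ n * norm (f t) * norm (exp (\<i> * of_real u) - (1 + \<i> * of_real u))"
        using t by (simp only: norm_mult[of _ "f t"] norm_mult[of "_ * f t"] norm_fl_kernel abs_of_nonneg)
      also have "\<dots> \<le> t ^ n * norm (f t) * u\<^sup>2"
      proof (rule mult_left_mono)
        have "norm (exp (\<i> * of_real u) - (1 + \<i> * of_real u)) \<le> \<bar>u\<bar> ^ 2 / 2"
          using iexp_approx1[of u 1] by (simp add: numeral_2_eq_2)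
        then show "norm (exp (\<i> * of_real u) - (1 + \<i> * of_real u)) \<le> u\<^sup>2"
          using zero_le_power2[of u] unfolding power2_abs by linarith
      qed (use t in simp)
      finally have "norm (E t) \<le> (y - \<alpha>)\<^sup>2 * (t ^ (n + 2) * norm (f t))"
        by (simp add: u_def power_mult_distrib power_add power2_commute power2_eq_square[of t] mult_ac)
      then have "(1 + t\<^sup>2) * norm (E t) \<le> (1 + t\<^sup>2) * ((y - \<alpha>)\<^sup>2 * (t ^ (n + 2) * norm (f t)))"
        by (intro mult_left_mono) auto
      also have "\<dots> \<le> (y - \<alpha>)\<^sup>2 * B"
        using mult_left_mono[OF B[OF t], of "(y - \<alpha>)\<^sup>2"] by (simp only: mult_ac zero_le_power2)
      finally show "(1 + t\<^sup>2) * norm (E t) \<le> (y - \<alpha>)\<^sup>2 * B" .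
    qed
    finally show "norm (fl_moment n f y - fl_moment n f \<alpha> - (y - \<alpha>) *\<^sub>R fl_moment (Suc n) f \<alpha>)
        \<le> (B * pi) * (y - \<alpha>)\<^sup>2"
      by (simp add: mult_ac)
  qed
qed

lemma fl_deriv_eq_fl_moment:
  assumes f: "rapidly_decreasing f"
  shows "fl_deriv n f \<alpha> = fl_moment n f \<alpha>"
proof -
  have "iter_deriv UNIV n (\<lambda>x. fourier_laplace f (of_real x)) = fl_moment n f"
  proof (induction n)
    case 0
    show ?case
      by (simp add: fun_eq_iff fourier_laplace_def fl_moment_def)
  next
    case (Suc n)
    show ?case
      using fl_moment_has_vector_derivative[OF f]
      by (auto simp: fun_eq_iff iter_deriv_Suc Suc intro!: vector_derivative_at)
  qed
  then show ?thesis
    by (simp add: fl_deriv_def)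
qed

lemma continuous_on_fl_moment:
  "rapidly_decreasing f \<Longrightarrow> continuous_on UNIV (fl_moment n f)"
  by (meson continuous_on_vector_derivative fl_moment_has_vector_derivative)

subsection \<open>A smooth bump\<close>

text \<open>For \<open>p = 1\<close> and \<open>N = 0\<close> this is the standard bump
  \<open>exp (- 1 / (x * (1 - x)))\<close> on the unit interval; general \<open>p\<close> and
  \<open>N\<close> make room for its derivatives.\<close>

definition bump :: "real poly \<Rightarrow> nat \<Rightarrow> real \<Rightarrow> real" where
  "bump p N x = (if 0 < x \<and> x < 1
     then poly p x / (x * (1 - x)) ^ N * exp (- (1 / (x * (1 - x)))) else 0)"

text \<open>The family of these functions is closed under differentiation; the factor \<open>exp\<close> absorbs any
  power of the denominator, so all of them vanish to second order at \<open>0\<close> and \<open>1\<close>.\<close>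

lemma bump_bound:
  obtains C where "\<And>x. \<bar>bump p N x\<bar> \<le> C" "C \<ge> 0"
    "\<And>x. 0 < x \<Longrightarrow> x < 1 \<Longrightarrow> \<bar>bump p N x\<bar> \<le> C * (x * (1 - x))\<^sup>2"
proof -
  obtain B where B: "\<And>x. x \<in> {0..1} \<Longrightarrow> \<bar>poly p x\<bar> \<le> B"
  proof -
    have "bounded (poly p ` {0..1})"
      by (intro compact_imp_bounded compact_continuous_image continuous_intros) auto
    then obtain B where "\<forall>x\<in>{0..1}. \<bar>poly p x\<bar> \<le> B"
      unfolding bounded_iff by auto
    then show ?thesis
      using that by blast
  qed
  \<comment> \<open>With \<open>q = x * (1 - x)\<close>, the inequality
    \<open>(1 + y / n) ^ n \<le> exp y\<close> at \<open>y = 1 / q\<close> gives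
    \<open>exp (- 1 / q) \<le> (n * q) ^ n\<close>. The exponent \<open>N + 2\<close> cancels the
    denominator \<open>q ^ N\<close> and leaves \<open>q^2\<close>.\<close>
  define n where "n = N + 2"
  define C where "C = B * real n ^ n"
  have "B \<ge> 0"
    using B[of 0] by (simp add: order.trans[OF abs_ge_zero])
  then have "C \<ge> 0"
    by (simp add: C_def)
  have le: "\<bar>bump p N x\<bar> \<le> C * (x * (1 - x))\<^sup>2" if x: "0 < x" "x < 1" for x
  proof -
    define q where "q = x * (1 - x)"
    have q: "q > 0"
      using x by (simp add: q_def)
    have "(1 / (real n * q)) ^ n \<le> (1 + (1 / q) / real n) ^ n"
      using q by (intro power_mono) (auto simp: mult.commute)
    also have "\<dots> \<le> exp (1 / q)"
      using q by (intro exp_ge_one_plus_x_over_n_power_n)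
        (auto simp: n_def intro: order.trans[of _ 0])
    finally have "1 / (real n * q) ^ n \<le> exp (1 / q)"
      by (simp only: power_one_over)
    moreover have "(real n * q) ^ n > 0"
      using q by (simp add: n_def)
    ultimately have "exp (- (1 / q)) \<le> (real n * q) ^ n"
      using le_imp_inverse_le[of "1 / (real n * q) ^ n" "exp (1 / q)"] by (simp add: exp_minus)
    then have "\<bar>poly p x\<bar> / q ^ N * exp (- (1 / q)) \<le> B / q ^ N * (real n * q) ^ n"
      using B[of x] x q by (intro mult_mono divide_right_mono) auto
    also have "\<dots> = C * q\<^sup>2"
    proof -
      have "q ^ n = q ^ N * q\<^sup>2"
        by (simp only: n_def power_add)
      then show ?thesis
        using q by (simp add: C_def power_mult_distrib)
    qed
    finally show ?thesis
      using x q by (simp add: bump_def abs_mult flip: q_def)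
  qed
  moreover have "\<bar>bump p N x\<bar> \<le> C" for x
  proof (cases "0 < x \<and> x < 1")
    case True
    then have "(x * (1 - x))\<^sup>2 \<le> 1"
      by (intro power_le_one) (auto intro: mult_le_one)
    then have "C * (x * (1 - x))\<^sup>2 \<le> C"
      using \<open>C \<ge> 0\<close> by (simp add: mult_left_le)
    with le[of x] True show ?thesis
      by linarith
  qed (use \<open>C \<ge> 0\<close> in \<open>auto simp: bump_def\<close>)
  ultimately show ?thesis
    using \<open>C \<ge> 0\<close> that by blast
qed

text \<open>With \<open>q = x * (1 - x)\<close>, encoded as \<open>[:0, 1, -1:]\<close>, and its
  derivative \<open>q'\<close>, encoded as \<open>[:1, -2:]\<close>, this is the numerator
  \<open>p' q^2 - N p q q' + p q'\<close> of the derivative over the denominator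
  \<open>q ^ (N + 2)\<close>.\<close>

definition bump_step :: "real poly \<Rightarrow> nat \<Rightarrow> real poly" where
  "bump_step p N = pderiv p * [:0, 1, -1:]\<^sup>2 - smult (of_nat N) (p * [:0, 1, -1:] * [:1, -2:]) + p * [:1, -2:]"

text \<open>Inside the interval this is the quotient rule. For \<open>x\<close> outside, endpoints
  included, \<open>y * (1 - y) \<le> \<bar>y - x\<bar>\<close> for all \<open>y\<close> inside, so
  the second-order vanishing from \<open>bump_bound\<close> becomes a quadratic bound around
  \<open>x\<close> and the derivative is 0.\<close>

lemma bump_has_derivative:
  "(bump p N has_real_derivative bump (bump_step p N) (N + 2) x) (at x)"
proof (cases "0 < x \<and> x < 1")
  case True
  define q where "q = x * (1 - x)"
  have q: "q > 0"
    using True by (simp add: q_def)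
  have "((\<lambda>x. poly p x / (x * (1 - x)) ^ N * exp (- (1 / (x * (1 - x))))) has_real_derivative
      ((poly (pderiv p) x * q ^ N - poly p x * (real N * (1 - 2 * x) * q ^ (N - 1))) / (q ^ N * q ^ N)
        * exp (- (1 / q)) + exp (- (1 / q)) * ((1 - 2 * x) / q\<^sup>2) * (poly p x / q ^ N))) (at x)"
  proof -
    define Q where "Q = (\<lambda>x::real. x * (1 - x))"
    have Q: "Q x = q" "Q x \<noteq> 0"
      using q by (auto simp: Q_def q_def)
    have dQ: "(Q has_real_derivative (1 - 2 * x)) (at x)"
      unfolding Q_def by (auto intro!: derivative_eq_intros)
    have "((\<lambda>x. poly p x / Q x ^ N) has_real_derivative
        (poly (pderiv p) x * q ^ N - poly p x * (real N * (1 - 2 * x) * q ^ (N - 1))) / (q ^ N * q ^ N)) (at x)"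
      using q by (auto intro!: derivative_eq_intros dQ simp: Q(1))
    moreover have "((\<lambda>x. exp (- (1 / Q x))) has_real_derivative exp (- (1 / q)) * ((1 - 2 * x) / q\<^sup>2)) (at x)"
      using q by (auto intro!: derivative_eq_intros dQ simp: Q(1) power2_eq_square field_simps)
    ultimately have "((\<lambda>x. poly p x / Q x ^ N * exp (- (1 / Q x))) has_real_derivative
        (poly (pderiv p) x * q ^ N - poly p x * (real N * (1 - 2 * x) * q ^ (N - 1))) / (q ^ N * q ^ N)
          * exp (- (1 / Q x)) + exp (- (1 / q)) * ((1 - 2 * x) / q\<^sup>2) * (poly p x / Q x ^ N)) (at x)"
      by (rule DERIV_mult)
    then show ?thesis
      unfolding Q(1) unfolding Q_def .
  qed
  also have "(poly (pderiv p) x * q ^ N - poly p x * (real N * (1 - 2 * x) * q ^ (N - 1))) / (q ^ N * q ^ N)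
        * exp (- (1 / q)) + exp (- (1 / q)) * ((1 - 2 * x) / q\<^sup>2) * (poly p x / q ^ N)
      = (poly (pderiv p) x * q\<^sup>2 - real N * (poly p x * q * (1 - 2 * x)) + poly p x * (1 - 2 * x))
         / q ^ (N + 2) * exp (- (1 / q))"
  \<comment> \<open>The exponent \<open>N - 1\<close> is truncated at \<open>N = 0\<close>, where
    the factor \<open>real N\<close> removes the term.\<close>
  proof (cases N)
    case (Suc n)
    show ?thesis
      using q by (simp add: Suc field_simps power2_eq_square)
  qed (use q in \<open>simp add: field_simps power2_eq_square\<close>)
  also have "\<dots> = bump (bump_step p N) (N + 2) x"
    using True by (simp add: bump_def bump_step_def q_def algebra_simps)
  finally have "((\<lambda>x. poly p x / (x * (1 - x)) ^ N * exp (- (1 / (x * (1 - x))))) has_real_derivative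
      bump (bump_step p N) (N + 2) x) (at x)" .
  then show ?thesis
  proof (rule has_field_derivative_transform_within_open)
    show "open {0<..<1::real}" "x \<in> {0<..<1}"
      using True by auto
  qed (auto simp: bump_def)
next
  case False
  then have x: "x \<le> 0 \<or> x \<ge> 1"
    by linarith
  obtain C where C: "C \<ge> 0" "\<And>x. 0 < x \<Longrightarrow> x < 1 \<Longrightarrow> \<bar>bump p N x\<bar> \<le> C * (x * (1 - x))\<^sup>2"
    by (rule bump_bound[of p N]) blast
  have "(bump p N has_vector_derivative 0) (at x)"
  proof (rule has_vector_derivative_quadratic_bound)
    fix y
    show "norm (bump p N y - bump p N x - (y - x) *\<^sub>R 0) \<le> C * (y - x)\<^sup>2"
    proof (cases "0 < y \<and> y < 1")
      case True
      have "y * (1 - y) \<le> y" "y * (1 - y) \<le> 1 - y"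
        using True by (auto simp: mult_left_le mult_left_le_one_le)
      then have "y * (1 - y) \<le> \<bar>y - x\<bar>"
        using x by linarith
      then have "(y * (1 - y))\<^sup>2 \<le> (y - x)\<^sup>2"
        using True by (metis abs_le_square_iff abs_of_nonneg diff_ge_0_iff_ge less_imp_le mult_nonneg_nonneg)
      then have "C * (y * (1 - y))\<^sup>2 \<le> C * (y - x)\<^sup>2"
        using C(1) by (intro mult_left_mono)
      moreover have "bump p N x = 0"
        using x by (auto simp: bump_def)
      ultimately show ?thesis
        using C(2)[of y] True by simp
    qed (use False C(1) in \<open>auto simp: bump_def\<close>)
  qed
  moreover have "bump (bump_step p N) (N + 2) x = 0"
    using x by (auto simp: bump_def)
  ultimately show ?thesis
    by (simp add: has_real_derivative_iff_has_vector_derivative)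
qed

text \<open>From here on the explicit formula is forgotten: \<open>D k\<close> is the
  \<open>k\<close>-th derivative of one bump, and \<kappa> a lower bound on its middle half.\<close>

lemma smooth_bump_exists:
  obtains D :: "nat \<Rightarrow> real \<Rightarrow> real" and M :: "nat \<Rightarrow> real" and \<kappa> :: real
  where "\<And>k x. (D k has_real_derivative D (Suc k) x) (at x)"
    and "\<And>k x. \<bar>D k x\<bar> \<le> M k"
    and "\<And>k x. x \<le> 0 \<or> x \<ge> 1 \<Longrightarrow> D k x = 0"
    and "\<And>x. D 0 x \<ge> 0"
    and "\<kappa> > 0" "\<And>x. 1/4 \<le> x \<Longrightarrow> x \<le> 3/4 \<Longrightarrow> D 0 x \<ge> \<kappa>"
proof -
  \<comment> \<open>Each differentiation raises the exponent of the denominator by 2, so the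
    \<open>k\<close>-th derivative has exponent \<open>2 * k\<close>.\<close>
  define p where "p = rec_nat (1 :: real poly) (\<lambda>k p. bump_step p (2 * k))"
  have "\<exists>M. \<forall>x. \<bar>bump (p k) (2 * k) x\<bar> \<le> M" for k
    using bump_bound by metis
  then obtain M where M: "\<And>k x. \<bar>bump (p k) (2 * k) x\<bar> \<le> M k"
    by metis
  show ?thesis
  \<comment> \<open>On \<open>[1/4, 3/4]\<close> the product \<open>x * (1 - x)\<close> is smallest
    at the ends, where it is \<open>3 / 16\<close>.\<close>
  proof (rule that[of "\<lambda>k. bump (p k) (2 * k)" M "exp (- (16 / 3))"])
    show "(bump (p k) (2 * k) has_real_derivative bump (p (Suc k)) (2 * Suc k) x) (at x)" for k x
      using bump_has_derivative[of "p k" "2 * k" x] by (simp add: p_def)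
    show "exp (- (16 / 3)) \<le> bump (p 0) (2 * 0) x" if x: "1/4 \<le> x" "x \<le> 3/4" for x :: real
    proof -
      have "x * (1 - x) - 3 / 16 = (x - 1/4) * (3/4 - x)"
        by (simp add: field_simps)
      also have "\<dots> \<ge> 0"
        using x by simp
      finally have "1 / (x * (1 - x)) \<le> 1 / (3 / 16)"
        by (intro divide_left_mono) auto
      then show ?thesis
        using x by (simp add: bump_def p_def)
    qed
  qed (use M in \<open>auto simp: bump_def p_def\<close>)
qed

subsection \<open>A smooth function with large moments\<close>

text \<open>The required growth \<open>K i\<close> is a function of the value already reached. This
  is what allows a new bump to be placed far enough out to outweigh everything caused by the earlier
  ones.\<close>

lemma fast_growing_sequence:
  fixes K :: "nat \<Rightarrow> real \<Rightarrow> real"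
  obtains T :: "nat \<Rightarrow> real" where
    "T 0 = 1" "mono T" "\<And>i. real i + 2 \<le> T (Suc i)" "\<And>i. K i (T i) \<le> T (Suc i)"
proof -
  define T where "T = rec_nat 1 (\<lambda>i w. max w (max (real i + 2) (K i w)))"
  show ?thesis
    by (rule that[of T]) (auto simp: T_def mono_iff_le_Suc)
qed

lemma rapidly_decreasing_of_real:
  assumes "\<And>t. isCont h t" "\<And>l. \<exists>B. \<forall>t\<ge>0. t ^ l * \<bar>h t\<bar> \<le> B"
  shows "rapidly_decreasing (\<lambda>t. of_real (h t :: real))"
  unfolding rapidly_decreasing_def
  using assms by (auto intro!: continuous_on_of_real continuous_at_imp_continuous_on)

text \<open>Over the support of \<open>p\<close> the phase changes by at most
  \<open>\<bar>\<alpha>\<bar> * \<delta> \<le> 1 < pi / 3\<close>. After a rotation the real part of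
  the integrand is thus at least half its modulus, and nothing cancels.\<close>

lemma fl_moment_lower_bound:
  fixes p :: "real \<Rightarrow> real"
  assumes p: "rapidly_decreasing (\<lambda>t. of_real (p t))" and nn: "\<And>t. p t \<ge> 0"
    and supp: "\<And>t. t \<le> T \<or> t \<ge> T + \<delta> \<Longrightarrow> p t = 0"
    and T: "T \<ge> 0" and \<delta>: "\<bar>\<alpha>\<bar> * \<delta> \<le> 1" and uv: "T \<le> u" "u \<le> v"
    and low: "\<And>t. u \<le> t \<Longrightarrow> t \<le> v \<Longrightarrow> p t \<ge> c" and c: "c \<ge> 0"
  shows "norm (fl_moment n (\<lambda>t. of_real (p t)) \<alpha>) \<ge> T ^ n * c / 2 * (v - u)"
proof -
  define k where "k = (\<lambda>t. (- \<i> * of_real t) ^ n * exp (- \<i> * of_real \<alpha> * of_real t))"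
  \<comment> \<open>The unimodular factor \<open>w\<close> makes the phase of the integrand vanish at \<open>t = T\<close>.\<close>
  define w where "w = \<i> ^ n * exp (\<i> * of_real \<alpha> * of_real T)"
  have nw: "norm w = 1"
    by (simp add: w_def norm_mult norm_power)
  have int: "set_integrable lborel {0..} (\<lambda>t. k t * of_real (p t))"
    unfolding k_def by (rule fl_moment_integrable[OF p])
  have wk: "w * (k t * of_real (p t)) = of_real (t ^ n * p t) * cis (- \<alpha> * (t - T))" for t
  proof -
    have "w * k t = (\<i> * (- \<i> * of_real t)) ^ n * exp (\<i> * of_real \<alpha> * of_real T + - \<i> * of_real \<alpha> * of_real t)"
      by (simp only: w_def k_def power_mult_distrib exp_add mult_ac)
    also have "\<i> * (- \<i> * of_real t) = complex_of_real t"
      by simp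
    also have "\<i> * of_real \<alpha> * of_real T + - \<i> * of_real \<alpha> * of_real t = \<i> * of_real (- \<alpha> * (t - T))"
      by (simp add: algebra_simps)
    finally show ?thesis
      by (simp add: cis_conv_exp mult_ac flip: mult.assoc[of w])
  qed
  have "T ^ n * c / 2 * (v - u) = (LINT t|lborel. T ^ n * c / 2 * indicator {u..v} t)"
    using uv by simp
  also have "\<dots> \<le> (LINT t|lborel. Re (indicator {0..} t *\<^sub>R (w * (k t * of_real (p t)))))"
  proof (rule integral_mono)
    show "integrable lborel (\<lambda>t. T ^ n * c / 2 * indicator {u..v} t :: real)"
      using uv by (intro integrable_mult_right integrable_real_indicator) auto
    show "integrable lborel (\<lambda>t. Re (indicator {0..} t *\<^sub>R (w * (k t * of_real (p t)))))"
      using set_integrable_mult_right[of w, OF int] unfolding set_integrable_def by (rule integrable_Re)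
    fix t :: real
    show "T ^ n * c / 2 * indicator {u..v} t \<le> Re (indicator {0..} t *\<^sub>R (w * (k t * of_real (p t))))"
    proof (cases "T \<le> t \<and> t \<le> T + \<delta>")
      case True
      then have "\<bar>\<alpha> * (t - T)\<bar> \<le> \<bar>\<alpha>\<bar> * \<delta>"
        by (auto simp: abs_mult intro!: mult_left_mono)
      also have "\<dots> \<le> pi / 3"
        using \<delta> pi_gt3 by simp
      finally have "cos (pi / 3) \<le> cos \<bar>\<alpha> * (t - T)\<bar>"
        by (intro cos_monotone_0_pi_le) auto
      then have cos: "1 / 2 \<le> cos (\<alpha> * (t - T))"
        by (simp add: cos_60)
      have "T ^ n * c / 2 * indicator {u..v} t \<le> T ^ n * p t * (1 / 2)"
        using low[of t] nn[of t] T by (auto simp: indicator_def intro!: mult_left_mono)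
      also have "\<dots> \<le> t ^ n * p t * cos (\<alpha> * (t - T))"
        using True cos nn[of t] T by (intro mult_mono power_mono mult_nonneg_nonneg) auto
      also have "\<dots> = Re (indicator {0..} t *\<^sub>R (w * (k t * of_real (p t))))"
        using True T by (simp add: wk)
      finally show ?thesis .
    next
      case False
      then have "p t = 0"
        using supp[of t] by linarith
      \<comment> \<open>If \<open>t\<close> lies in \<open>[u, v]\<close> although
        \<open>p t = 0\<close>, then \<open>0 \<le> c \<le> p t\<close> forces
        \<open>c = 0\<close>.\<close>
      moreover have "T ^ n * c / 2 * indicator {u..v} t \<le> 0"
      proof (cases "u \<le> t \<and> t \<le> v")
        case True
        then have "c = 0"
          using low[of t] c \<open>p t = 0\<close> by simp
        then show ?thesis
          by simp
      qed auto
      ultimately show ?thesis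
        by simp
    qed
  qed
  also have "\<dots> = Re (LINT t:{0..}|lborel. w * (k t * of_real (p t)))"
    using set_integrable_mult_right[of w, OF int] unfolding set_integrable_def set_lebesgue_integral_def
    by (rule integral_Re)
  also have "\<dots> = Re (w * fl_moment n (\<lambda>t. of_real (p t)) \<alpha>)"
    unfolding fl_moment_def k_def by (simp only: set_integral_mult_right)
  also have "\<dots> \<le> norm (w * fl_moment n (\<lambda>t. of_real (p t)) \<alpha>)"
    by (rule complex_Re_le_cmod)
  finally show ?thesis
    by (simp add: norm_mult nw)
qed

lemma power_quotient_le:
  fixes T :: real
  assumes T: "T \<ge> 2" and "a + b \<le> c"
  shows "T ^ a / T ^ c \<le> (1 / 2) ^ b"
proof -
  have "T ^ a * 2 ^ b \<le> T ^ a * T ^ b"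
    using T by (intro mult_left_mono power_mono) auto
  also have "\<dots> \<le> T ^ c"
    using assms by (auto simp flip: power_add intro!: power_increasing)
  finally show ?thesis
    using T by (simp add: field_simps power_one_over)
qed

text \<open>The thresholds \<open>A\<close> are arbitrary, so that they can later be adapted to a
  given function. The height exponent \<open>4 * i + 3\<close> is one less than the order
  \<open>4 * i + 4\<close>, hence the gain of one factor \<open>T i\<close>; the weight
  \<open>1 + t^2\<close> raises the order to \<open>4 * i + 6\<close>, still below the next height
  exponent \<open>4 * i + 7\<close>.\<close>

lemma large_moments:
  fixes A :: "nat \<Rightarrow> real"
  obtains H :: "nat \<Rightarrow> real \<Rightarrow> real" where
    "\<And>k t. (H k has_real_derivative H (Suc k) t) (at t)"
    "\<And>k l. \<exists>B. \<forall>t\<ge>0. t ^ l * \<bar>H k t\<bar> \<le> B"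
    "\<And>i \<alpha>. \<bar>\<alpha>\<bar> \<le> real (Suc i) \<Longrightarrow> A i \<le> norm (fl_moment (4 * i + 4) (\<lambda>t. of_real (H 0 t)) \<alpha>)"
proof -
  obtain D M \<kappa> where D: "\<And>k x. (D k has_real_derivative D (Suc k) x) (at x)"
    and M: "\<And>k x. \<bar>D k x\<bar> \<le> M k" and D0: "\<And>k x. x \<le> 0 \<or> x \<ge> 1 \<Longrightarrow> D k x = 0"
    and Dnn: "\<And>x. D 0 x \<ge> 0" and \<kappa>: "\<kappa> > 0" "\<And>x. 1/4 \<le> x \<Longrightarrow> x \<le> 3/4 \<Longrightarrow> D 0 x \<ge> \<kappa>"
    by (rule smooth_bump_exists) blast
  have Mnn: "M k \<ge> 0" for k
    using M[of k 0] by (simp add: order.trans[OF abs_ge_zero])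
  \<comment> \<open>A bound for the weighted sum of all bumps but the \<open>i\<close>-th, with
    \<open>w = S i\<close>: the first 2 comes from \<open>1 + t^2 \<le> 2 * t^2\<close>, the power
    of 2 from \<open>t \<le> 2 * T j\<close> on the supports, and \<open>2 ^ i * 2\<close> from
    summing \<open>2 ^ i * (1 / 2) ^ j\<close> over \<open>j\<close>.\<close>
  define R where "R = (\<lambda>i w. 2 * 2 ^ (4 * i + 6) * M 0 * w ^ (4 * i + 6) * 2 ^ i * 2 :: real)"
  obtain S where S: "S 0 = 1" "mono S" "\<And>i. real i + 2 \<le> S (Suc i)"
    "\<And>i. (A i + R i (S i) * pi) * (4 * real (Suc i)) / \<kappa> \<le> S (Suc i)"
    by (rule fast_growing_sequence[of "\<lambda>i w. (A i + R i w * pi) * (4 * real (Suc i)) / \<kappa>"]) blast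
  \<comment> \<open>The shift makes \<open>S i\<close> a bound for all earlier positions
    \<open>T j\<close>, \<open>j < i\<close>, and leaves \<open>S 0 = 1\<close> for the case that
    there are none.\<close>
  define T where "T = (\<lambda>i. S (Suc i))"
  have T2: "T i \<ge> 2" and Ti: "T i \<ge> real (Suc i)" for i
    using S(3)[of i] by (auto simp: T_def)
  \<comment> \<open>The \<open>k\<close>-th derivative of the \<open>i\<close>-th bump; the factor
    \<open>real (Suc i) ^ k\<close> is due to the contraction to width
    \<open>1 / (i + 1)\<close>.\<close>
  define P where "P = (\<lambda>k i t. real (Suc i) ^ k * D k (real (Suc i) * (t - T i)) / T i ^ (4 * i + 3))"
  define H where "H = (\<lambda>k t. \<Sum>i. P k i t)"
  \<comment> \<open>Majorant of \<open>t ^ l * P k i t\<close>, from \<open>t \<le> 2 * T i\<close>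
    on the support and \<open>i + 1 \<le> T i\<close>. Its summability yields termwise
    differentiation as well as rapid decrease of every \<open>H k\<close>.\<close>
  define G where "G = (\<lambda>l k i. 2 ^ l * M k * (T i ^ (l + k) / T i ^ (4 * i + 3)))"
  have P_deriv: "(P k i has_real_derivative P (Suc k) i t) (at t)" for k i t
  proof -
    have "((\<lambda>t. D k (real (Suc i) * (t - T i))) has_real_derivative
        D (Suc k) (real (Suc i) * (t - T i)) * real (Suc i)) (at t)"
      by (rule DERIV_chain2[OF D]) (auto intro!: derivative_eq_intros)
    from DERIV_cmult[OF this, of "real (Suc i) ^ k / T i ^ (4 * i + 3)"] show ?thesis
      unfolding P_def by (simp add: mult_ac)
  qed
  have P0: "P k i t = 0" if "t \<le> T i \<or> t \<ge> T i + 1 / real (Suc i)" for k i t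
  proof -
    have "real (Suc i) * (t - T i) \<le> 0 \<or> real (Suc i) * (t - T i) \<ge> 1"
      using that
    proof
      assume "t \<le> T i"
      then show ?thesis
        by (simp add: mult_le_0_iff)
    qed (simp add: field_simps)
    then show ?thesis
      by (simp only: P_def D0 mult_zero_right div_0)
  qed
  have P_le: "\<bar>t ^ l * P k i t\<bar> \<le> G l k i" for l k i t
  proof (cases "t \<le> T i \<or> t \<ge> T i + 1 / real (Suc i)")
    case True
    show ?thesis
      using T2[of i] Mnn[of k] by (simp add: P0[OF True] G_def)
  next
    case False
    moreover have "1 / real (Suc i) \<le> 1"
      by simp
    ultimately have t: "0 \<le> t" "t \<le> 2 * T i"
      using T2[of i] by linarith+
    have "\<bar>t ^ l * P k i t\<bar> = t ^ l * (real (Suc i) ^ k * \<bar>D k (real (Suc i) * (t - T i))\<bar>) / T i ^ (4 * i + 3)"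
      using t T2[of i] by (simp add: P_def abs_mult)
    also have "\<dots> \<le> (2 * T i) ^ l * (T i ^ k * M k) / T i ^ (4 * i + 3)"
      using t T2[of i] Ti[of i] M
      by (intro divide_right_mono mult_mono power_mono mult_nonneg_nonneg) auto
    also have "\<dots> = G l k i"
      by (simp add: G_def power_mult_distrib power_add mult_ac)
    finally show ?thesis .
  qed
  have G_sum: "summable (G l k)" for l k
  proof (rule summable_comparison_test')
    show "summable (\<lambda>i. 2 ^ l * M k * (1 / 2 :: real) ^ i)"
      by (intro summable_mult summable_geometric) simp
    fix i assume "i \<ge> l + k"
    then have "T i ^ (l + k) / T i ^ (4 * i + 3) \<le> (1 / 2) ^ i"
      by (intro power_quotient_le T2) auto
    then have "G l k i \<le> 2 ^ l * M k * (1 / 2) ^ i"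
      unfolding G_def using Mnn[of k] by (intro mult_left_mono) auto
    moreover have "G l k i \<ge> 0"
      using T2[of i] Mnn[of k] by (simp add: G_def)
    ultimately show "norm (G l k i) \<le> 2 ^ l * M k * (1 / 2) ^ i"
      by simp
  qed
  have P_summable: "summable (\<lambda>i. t ^ l * P k i t)" for t l k
    by (rule summable_comparison_test'[OF G_sum]) (use P_le in auto)
  have H_sums: "(\<lambda>i. P k i t) sums H k t" for k t
    using P_summable[of t 0 k] by (simp add: H_def summable_sums)
  have H_deriv: "(H k has_real_derivative H (Suc k) t) (at t)" for k t
    unfolding H_def
  proof (rule has_field_derivative_series'(2))
    show "convex (UNIV :: real set)" "t \<in> UNIV" "t \<in> interior UNIV"
      by auto
    show "(P k i has_real_derivative P (Suc k) i x) (at x within UNIV)" for i x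
      using P_deriv by simp
    show "uniformly_convergent_on UNIV (\<lambda>n x. \<Sum>i<n. P (Suc k) i x)"
      by (rule Weierstrass_m_test'[OF _ G_sum[of 0 "Suc k"]]) (use P_le[of _ 0] in auto)
    show "summable (\<lambda>i. P k i t)"
      using H_sums by (rule sums_summable)
  qed
  have H_decay: "t ^ l * \<bar>H k t\<bar> \<le> (\<Sum>i. G l k i)" if "t \<ge> 0" for l k t
  proof -
    have "\<bar>t ^ l * H k t\<bar> = \<bar>\<Sum>i. t ^ l * P k i t\<bar>"
      using sums_unique[OF sums_mult[OF H_sums]] by simp
    also have "\<dots> \<le> (\<Sum>i. G l k i)"
      using norm_suminf_le[OF _ G_sum, of "\<lambda>i. t ^ l * P k i t"] P_le by simp
    finally show ?thesis
      using that by (simp add: abs_mult)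
  qed
  have rdH: "rapidly_decreasing (\<lambda>t. of_real (H 0 t))"
    using H_decay DERIV_isCont[OF H_deriv] by (intro rapidly_decreasing_of_real) blast+
  have rdP: "rapidly_decreasing (\<lambda>t. of_real (P 0 i t))" for i
  proof (rule rapidly_decreasing_of_real)
    show "\<exists>B. \<forall>t\<ge>0. t ^ l * \<bar>P 0 i t\<bar> \<le> B" for l
      using P_le[of _ l 0 i] by (metis abs_mult abs_of_nonneg zero_le_power)
  qed (rule DERIV_isCont[OF P_deriv])
  have "A i \<le> norm (fl_moment (4 * i + 4) (\<lambda>t. of_real (H 0 t)) \<alpha>)" if \<alpha>: "\<bar>\<alpha>\<bar> \<le> real (Suc i)" for i \<alpha>
  proof -
    define n where "n = 4 * i + 4"
    let ?C = "4 * real (Suc i)"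
    have main: "norm (fl_moment n (\<lambda>t. of_real (P 0 i t)) \<alpha>) \<ge> T i * \<kappa> / ?C"
    proof -
      define c where "c = \<kappa> / T i ^ (4 * i + 3)"
      \<comment> \<open>The width \<open>1 / (i + 1)\<close> turns the bound on \<alpha> into the
        phase condition, and on the interval used here the argument of \<open>D 0\<close> runs
        through \<open>[1/4, 3/4]\<close>.\<close>
      have "norm (fl_moment n (\<lambda>t. of_real (P 0 i t)) \<alpha>) \<ge>
          T i ^ n * c / 2 * ((T i + 3 / ?C) - (T i + 1 / ?C))"
      proof (rule fl_moment_lower_bound[OF rdP, where \<delta> = "1 / real (Suc i)"])
        show "P 0 i t \<ge> 0" for t
          using Dnn T2[of i] by (simp add: P_def)
        show "P 0 i t \<ge> c" if "T i + 1 / ?C \<le> t" "t \<le> T i + 3 / ?C" for t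
        proof -
          have "1 / 4 \<le> real (Suc i) * (t - T i)" "real (Suc i) * (t - T i) \<le> 3 / 4"
            using that by (auto simp: field_simps)
          then show ?thesis
            using \<kappa>(2) T2[of i] unfolding P_def c_def by (simp add: divide_right_mono)
        qed
      qed (use \<alpha> \<kappa> T2[of i] P0 in \<open>auto simp: c_def field_simps\<close>)
      also have "T i ^ n * c / 2 * ((T i + 3 / ?C) - (T i + 1 / ?C)) = T i * \<kappa> / ?C"
      proof -
        have "T i ^ n = T i * T i ^ (4 * i + 3)"
          by (simp add: n_def power_add power_numeral_reduce)
        then have "T i ^ n * c = T i * \<kappa>"
          using T2[of i] by (simp add: c_def)
        then show ?thesis
          by (simp add: diff_divide_distrib[symmetric])
      qed
      finally show ?thesis .
    qed
    define r where "r = (\<lambda>t. complex_of_real (H 0 t - P 0 i t))"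
    have rdr: "rapidly_decreasing r"
      using rapidly_decreasing_linear[OF rdH rdP, of 1 "-1" i] by (simp add: r_def)
    \<comment> \<open>The remaining bumps are estimated pointwise by a geometric series
      \<open>g\<close>, with the term \<open>j = i\<close> replaced by 0 in
      \<open>f\<close>.\<close>
    have "norm (fl_moment n r \<alpha>) \<le> R i (S i) * pi"
    proof (rule fl_moment_le[OF rdr])
      fix t :: real assume t: "t \<ge> 0"
      define f where "f = (\<lambda>j. if j = i then 0 else (1 + t\<^sup>2) * t ^ n * P 0 j t)"
      define g where "g = (\<lambda>j. 2 * 2 ^ (n + 2) * M 0 * S i ^ (n + 2) * 2 ^ i * (1 / 2 :: real) ^ j)"
      have S1: "S i \<ge> 1"
        using monoD[OF S(2), of 0 i] S(1) by simp
      have "(\<lambda>j. if j = i then P 0 i t else 0) sums P 0 i t"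
        using sums_If_finite[of "\<lambda>j. j = i" "\<lambda>j. P 0 j t"] by (simp cong: if_cong)
      then have "(\<lambda>j. P 0 j t - (if j = i then P 0 i t else 0)) sums (H 0 t - P 0 i t)"
        using H_sums by (intro sums_diff)
      then have "(\<lambda>j. (1 + t\<^sup>2) * t ^ n * (P 0 j t - (if j = i then P 0 i t else 0)))
          sums ((1 + t\<^sup>2) * t ^ n * (H 0 t - P 0 i t))"
        by (rule sums_mult)
      then have "f sums ((1 + t\<^sup>2) * t ^ n * (H 0 t - P 0 i t))"
        by (rule sums_cong[THEN iffD1, rotated]) (simp add: f_def)
      moreover have fg: "norm (f j) \<le> g j" for j
      proof (cases "j = i")
        case True
        then show ?thesis
          using Mnn[of 0] S1 by (simp add: f_def g_def)
      next
        case False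
        \<comment> \<open>Earlier bumps satisfy \<open>T j \<le> S i\<close>, and
          \<open>2 ^ i * (1 / 2) ^ j \<ge> 1\<close>. For later ones
          \<open>(n + 2) + (j - i) \<le> 4 * j + 3\<close>, with equality at
          \<open>j = i + 1\<close>, so the height supplies the factor
          \<open>(1 / 2) ^ (j - i)\<close>.\<close>
        have quot: "T j ^ (n + 2) / T j ^ (4 * j + 3) \<le> S i ^ (n + 2) * 2 ^ i * (1 / 2) ^ j"
        proof (cases "j < i")
          case True
          have "T j ^ (n + 2) / T j ^ (4 * j + 3) \<le> T j ^ (n + 2) / 1"
            using T2[of j] by (intro divide_left_mono one_le_power) auto
          also have "\<dots> \<le> S i ^ (n + 2)"
            unfolding div_by_1 using T2[of j] monoD[OF S(2), of "Suc j" i] True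
            by (intro power_mono) (auto simp: T_def)
          also have "\<dots> \<le> S i ^ (n + 2) * (2 ^ i * (1 / 2) ^ j)"
          proof -
            have "(2::real) ^ j \<le> 2 ^ i"
              using True by (intro power_increasing) auto
            then have "1 \<le> (2::real) ^ i * (1 / 2) ^ j"
              by (simp add: power_one_over)
            then show ?thesis
              using S1 mult_left_mono[of 1 "2 ^ i * (1 / 2) ^ j" "S i ^ (n + 2)"] by simp
          qed
          finally show ?thesis
            by (simp add: mult.assoc)
        next
          case ge: False
          then have "T j ^ (n + 2) / T j ^ (4 * j + 3) \<le> (1 / 2) ^ (j - i)"
            using False by (intro power_quotient_le T2) (auto simp: n_def)
          also have "\<dots> = 2 ^ i * (1 / 2) ^ j"
            using ge by (simp add: power_one_over power_diff)
          also have "\<dots> \<le> S i ^ (n + 2) * (2 ^ i * (1 / 2) ^ j)"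
            using mult_right_mono[OF one_le_power[OF S1], of "2 ^ i * (1 / 2) ^ j" "n + 2"] by simp
          finally show ?thesis
            by (simp add: mult.assoc)
        qed
        have "norm (f j) = (1 + t\<^sup>2) * \<bar>t ^ n * P 0 j t\<bar>"
          using False t by (simp add: f_def abs_mult)
        also have "\<dots> \<le> 2 * \<bar>t ^ (n + 2) * P 0 j t\<bar>"
        proof (cases "t \<le> T j")
          case True
          then show ?thesis
            by (simp add: P0)
        next
          case False
          then have "1 \<le> t"
            using T2[of j] by linarith
          then have "1 + t\<^sup>2 \<le> 2 * t\<^sup>2"
            by (simp add: one_le_power)
          then have "(1 + t\<^sup>2) * \<bar>t ^ n * P 0 j t\<bar> \<le> 2 * t\<^sup>2 * \<bar>t ^ n * P 0 j t\<bar>"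
            by (intro mult_right_mono) auto
          then show ?thesis
            using t by (simp add: abs_mult power_add power2_eq_square mult_ac)
        qed
        also have "\<dots> \<le> 2 * G (n + 2) 0 j"
          using P_le[of t "n + 2" 0 j] by simp
        also have "\<dots> \<le> 2 * (2 ^ (n + 2) * M 0 * (S i ^ (n + 2) * 2 ^ i * (1 / 2) ^ j))"
          unfolding G_def using quot Mnn[of 0] by (intro mult_left_mono) auto
        finally show ?thesis
          by (simp add: g_def mult_ac)
      qed
      moreover have "g sums R i (S i)"
      proof -
        have "(\<lambda>j. 2 * 2 ^ (n + 2) * M 0 * S i ^ (n + 2) * 2 ^ i * (1 / 2 :: real) ^ j) sums
            (2 * 2 ^ (n + 2) * M 0 * S i ^ (n + 2) * 2 ^ i * (1 / (1 - 1 / 2)))"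
          by (intro sums_mult geometric_sums) simp
        then show ?thesis
          by (simp add: g_def R_def n_def add.commute)
      qed
      ultimately have "norm ((1 + t\<^sup>2) * t ^ n * (H 0 t - P 0 i t)) \<le> R i (S i)"
        using norm_suminf_le[of f g] sums_unique sums_summable by metis
      then show "(1 + t\<^sup>2) * (t ^ n * norm (r t)) \<le> R i (S i)"
        using t unfolding r_def norm_of_real by (simp add: abs_mult mult.assoc)
    qed
    moreover have "norm (fl_moment n (\<lambda>t. of_real (H 0 t)) \<alpha>) \<ge>
        norm (fl_moment n (\<lambda>t. of_real (P 0 i t)) \<alpha>) - norm (fl_moment n r \<alpha>)"
    proof -
      have "fl_moment n r \<alpha> = fl_moment n (\<lambda>t. of_real (H 0 t)) \<alpha> - fl_moment n (\<lambda>t. of_real (P 0 i t)) \<alpha>"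
        using fl_moment_linear[OF rdH rdP, of n 1 "-1" i \<alpha>] by (simp add: r_def)
      then show ?thesis
        by (metis norm_minus_commute norm_triangle_ineq2 diff_le_eq add.commute)
    qed
    \<comment> \<open>The growth condition imposed on \<open>S\<close> pays for both the threshold
      and the remainder.\<close>
    moreover have "A i + R i (S i) * pi \<le> T i * \<kappa> / ?C"
      using S(4)[of i] \<kappa>(1) by (simp add: T_def field_simps)
    ultimately show ?thesis
      using main by (simp add: n_def)
  qed
  with H_deriv H_decay show ?thesis
    by (intro that[of H]) blast+
qed

subsection \<open>Seminorms and perturbations\<close>

text \<open>Gives uniqueness of derivatives within the half-line, also of the one-sided ones at
  0.\<close>

lemma at_within_half_line_neq_bot:
  assumes "t \<ge> 0"
  shows "at t within {0::real..} \<noteq> bot"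
proof -
  have "at_right t \<le> at t within {0..}"
    using assms by (intro at_le) auto
  then show ?thesis
    using trivial_limit_at_right_real[of t] by (metis bot.extremum_uniqueI)
qed

lemma differentiable_on_transform:
  assumes "f differentiable_on S" "\<And>t. t \<in> S \<Longrightarrow> f t = g t"
  shows "g differentiable_on S"
  unfolding differentiable_on_def
proof
  fix t assume "t \<in> S"
  then show "g differentiable at t within S"
    using assms by (intro differentiable_transform_within[of f t S 1 g]) (auto simp: differentiable_on_def)
qed

text \<open>Both functions have the same derivatives within \<open>S\<close>, so the choice behind
  \<open>vector_derivative\<close> returns the same value even where no derivative exists.\<close>

lemma iter_deriv_cong:
  assumes "\<And>t. t \<in> S \<Longrightarrow> f t = g t" "t \<in> S"
  shows "iter_deriv S k f t = iter_deriv S k g t"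
  using assms(2)
proof (induction k arbitrary: t)
  case (Suc k)
  have "(iter_deriv S k f has_vector_derivative d) (at t within S) \<longleftrightarrow>
      (iter_deriv S k g has_vector_derivative d) (at t within S)" for d
    using has_vector_derivative_transform[OF Suc.prems, of "iter_deriv S k f" "iter_deriv S k g" d]
      has_vector_derivative_transform[OF Suc.prems, of "iter_deriv S k g" "iter_deriv S k f" d] Suc.IH
    by metis
  then show ?case
    by (simp add: iter_deriv_Suc vector_derivative_def)
qed (use assms(1) in simp)

lemma C_half_line_cong:
  assumes "\<And>t. t \<ge> 0 \<Longrightarrow> f t = g t"
  shows "C_half_line m f \<longleftrightarrow> C_half_line m g"
proof -
  have eq: "t \<in> {0..} \<Longrightarrow> iter_deriv {0..} k f t = iter_deriv {0..} k g t" for k t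
    using assms by (intro iter_deriv_cong) auto
  have "continuous_on {0..} (iter_deriv {0..} k f) \<longleftrightarrow> continuous_on {0..} (iter_deriv {0..} k g)" for k
    using eq by (intro continuous_on_cong) auto
  moreover have "iter_deriv {0..} k f differentiable_on {0..} \<longleftrightarrow> iter_deriv {0..} k g differentiable_on {0..}" for k
    using eq[of _ k] differentiable_on_transform by metis
  ultimately show ?thesis
    unfolding C_half_line_def by simp
qed

lemma iter_deriv_has_vector_derivative:
  assumes "C_half_line m f" "enat k < m" "t \<ge> 0"
  shows "(iter_deriv {0..} k f has_vector_derivative iter_deriv {0..} (Suc k) f t) (at t within {0..})"
  using assms unfolding C_half_line_def differentiable_on_def
  by (auto simp: iter_deriv_Suc vector_derivative_works)

lemma iter_deriv_linear:
  assumes f: "C_half_line m f" and g: "C_half_line m g" and "enat k \<le> m" "t \<ge> 0"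
  shows "iter_deriv {0..} k (\<lambda>t. a * f t + b * g t) t = a * iter_deriv {0..} k f t + b * iter_deriv {0..} k g t"
  using assms(3,4)
proof (induction k arbitrary: t)
  case (Suc k)
  have k: "enat k < m"
    using Suc.prems(1) by (simp add: Suc_ile_eq)
  have "(iter_deriv {0..} k (\<lambda>t. a * f t + b * g t) has_vector_derivative
      a * iter_deriv {0..} (Suc k) f t + b * iter_deriv {0..} (Suc k) g t) (at t within {0..})"
  proof (rule has_vector_derivative_transform)
    show "((\<lambda>t. a * iter_deriv {0..} k f t + b * iter_deriv {0..} k g t) has_vector_derivative
        a * iter_deriv {0..} (Suc k) f t + b * iter_deriv {0..} (Suc k) g t) (at t within {0..})"
      using f g k Suc.prems(2)
      by (intro has_vector_derivative_add has_vector_derivative_mult_right iter_deriv_has_vector_derivative)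
  qed (use Suc k in auto)
  then show ?case
    using Suc.prems(2)
    by (simp add: iter_deriv_Suc[of _ _ "\<lambda>t. a * f t + b * g t"] vector_derivative_within at_within_half_line_neq_bot)
qed simp

lemma C_half_line_linear:
  assumes f: "C_half_line m f" and g: "C_half_line m g"
  shows "C_half_line m (\<lambda>t. a * f t + b * g t)"
proof -
  have eq: "iter_deriv {0..} k (\<lambda>t. a * f t + b * g t) t = a * iter_deriv {0..} k f t + b * iter_deriv {0..} k g t"
    if "enat k \<le> m" "t \<in> {0..}" for k t
    using iter_deriv_linear[OF f g that(1)] that(2) by simp
  show ?thesis
    unfolding C_half_line_def
  proof (intro conjI allI impI)
    fix k assume k: "enat k < m"
    have "(\<lambda>t. a * iter_deriv {0..} k f t + b * iter_deriv {0..} k g t) differentiable_on {0..}"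
      using f g k by (auto simp: C_half_line_def intro!: derivative_intros)
    then show "iter_deriv {0..} k (\<lambda>t. a * f t + b * g t) differentiable_on {0..}"
      by (rule differentiable_on_transform) (simp only: eq[OF less_imp_le[OF k]])
  next
    fix k assume k: "enat k \<le> m"
    have "continuous_on {0..} (\<lambda>t. a * iter_deriv {0..} k f t + b * iter_deriv {0..} k g t)"
      using f g k by (auto simp: C_half_line_def intro!: continuous_intros)
    then show "continuous_on {0..} (iter_deriv {0..} k (\<lambda>t. a * f t + b * g t))"
      by (rule continuous_on_eq) (simp only: eq[OF k])
  qed
qed

lemma
  fixes H :: "nat \<Rightarrow> real \<Rightarrow> real"
  assumes H: "\<And>k t. (H k has_real_derivative H (Suc k) t) (at t)"
  shows iter_deriv_smooth: "t \<ge> 0 \<Longrightarrow> iter_deriv {0..} k (\<lambda>t. of_real (H 0 t)) t = of_real (H k t)"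
    and C_half_line_smooth: "C_half_line m (\<lambda>t. of_real (H 0 t))"
proof -
  have d: "((\<lambda>t. complex_of_real (H k t)) has_vector_derivative of_real (H (Suc k) t)) (at t within S)" for k t S
    using has_vector_derivative_of_real[OF H] has_vector_derivative_at_within by blast
  have eq: "iter_deriv {0..} k (\<lambda>t. of_real (H 0 t)) t = of_real (H k t)" if "t \<in> {0..}" for k t
    using that
  proof (induction k arbitrary: t)
    case (Suc k)
    have "(iter_deriv {0..} k (\<lambda>t. of_real (H 0 t)) has_vector_derivative of_real (H (Suc k) t)) (at t within {0..})"
      by (rule has_vector_derivative_transform[OF Suc.prems Suc.IH d])
    then show ?case
      using Suc.prems by (simp add: iter_deriv_Suc vector_derivative_within at_within_half_line_neq_bot)
  qed simp
  then show "t \<ge> 0 \<Longrightarrow> iter_deriv {0..} k (\<lambda>t. of_real (H 0 t)) t = of_real (H k t)"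
    by simp
  have diff: "iter_deriv {0..} k (\<lambda>t. of_real (H 0 t)) differentiable_on {0..}" for k
    unfolding differentiable_on_def
    by (metis eq d has_vector_derivative_transform differentiableI_vector)
  then show "C_half_line m (\<lambda>t. of_real (H 0 t))"
    unfolding C_half_line_def by (auto intro: differentiable_imp_continuous_on)
qed

section \<open>Seminorm inequalities as pointwise bounds, and the growth condition on
  moments\<close>

lemma rho_le_iff:
  "rho l k u \<le> ereal r \<longleftrightarrow> (\<forall>t\<ge>0. t ^ l * norm (iter_deriv {0..} k u t) \<le> r)"
  unfolding rho_def SUP_le_iff by auto

lemma rho_less_top_iff:
  "rho l k u < \<infinity> \<longleftrightarrow> (\<exists>B. \<forall>t\<ge>0. t ^ l * norm (iter_deriv {0..} k u t) \<le> B)"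
proof -
  have "rho l k u < \<infinity> \<longleftrightarrow> (\<exists>B. rho l k u \<le> ereal B)"
    by (cases "rho l k u") auto
  then show ?thesis
    by (simp only: rho_le_iff)
qed

text \<open>A strict pointwise bound by \<open>e\<close> would be too weak, as the supremum may
  equal \<open>e\<close>. The gap between \<open>r\<close> and \<open>e\<close> is the room
  available for perturbations.\<close>

lemma rho_less_iff:
  "rho l k u < ereal e \<longleftrightarrow> (\<exists>r<e. \<forall>t\<ge>0. t ^ l * norm (iter_deriv {0..} k u t) \<le> r)"
proof -
  have "rho l k u < ereal e \<longleftrightarrow> (\<exists>r<e. rho l k u \<le> ereal r)"
  proof
    assume *: "rho l k u < ereal e"
    show "\<exists>r<e. rho l k u \<le> ereal r"
      by (rule ereal_dense2[OF *, THEN exE]) (metis * ereal_dense2 ereal_less(2) less_ereal.simps(1) less_imp_le)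
  qed (auto intro: le_less_trans)
  then show ?thesis
    by (simp only: rho_le_iff)
qed

lemma schwartz_imp_rapidly_decreasing:
  assumes "f \<in> schwartz_half_line m"
  shows "rapidly_decreasing f"
proof -
  have "enat 0 \<le> m"
    by (simp flip: zero_enat_def)
  then have "continuous_on {0..} (iter_deriv {0..} 0 f)" "\<forall>l. rho l 0 f < \<infinity>"
    using assms unfolding schwartz_half_line_def C_half_line_def by blast+
  then show ?thesis
    unfolding rapidly_decreasing_def rho_less_top_iff by simp
qed

text \<open>This form exhibits a countable intersection over \<open>M\<close> and avoids roots.
  Requiring \<open>n > M\<close> makes \<open>n\<close> positive, where \<open>root n\<close> is
  strictly monotone, and yields arbitrarily large orders.\<close>

lemma r_inv_eq_infinity_iff:
  assumes f: "rapidly_decreasing f"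
  shows "r_inv f \<alpha> = \<infinity> \<longleftrightarrow> (\<forall>M. \<exists>n>M. real M ^ n * fact n < norm (fl_moment n f \<alpha>))"
proof -
  define x where "x = (\<lambda>n. norm (fl_moment n f \<alpha>) / fact n)"
  have x: "x n \<ge> 0" for n
    by (simp add: x_def)
  have r: "r_inv f \<alpha> = limsup (\<lambda>n. ereal (root n (x n)))"
    by (simp add: r_inv_def fl_deriv_eq_fl_moment[OF f] x_def)
  have less: "real M ^ n < x n \<longleftrightarrow> real M < root n (x n)" if "n > M" for n M
    using that x[of n]
    by (metis not_less_zero of_nat_0_le_iff real_root_less_iff real_root_power_cancel neq0_conv)
  have "limsup (\<lambda>n. ereal (root n (x n))) = \<infinity> \<longleftrightarrow> (\<forall>M. \<exists>n>M. real M < root n (x n))"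
  proof (intro iffI allI)
    fix M :: nat
    assume inf: "limsup (\<lambda>n. ereal (root n (x n))) = \<infinity>"
    show "\<exists>n>M. real M < root n (x n)"
    proof (rule ccontr)
      assume "\<not> ?thesis"
      then have "limsup (\<lambda>n. ereal (root n (x n))) \<le> ereal (real M)"
        by (intro Limsup_bounded eventually_sequentiallyI[of "Suc M"]) (force simp: not_less Suc_le_eq)
      then show False
        using inf by simp
    qed
  next
    assume large: "\<forall>M. \<exists>n>M. real M < root n (x n)"
    show "limsup (\<lambda>n. ereal (root n (x n))) = \<infinity>"
    proof (rule ccontr)
      assume "\<not> ?thesis"
      then obtain M :: nat where "limsup (\<lambda>n. ereal (root n (x n))) < ereal (real M)"
        using less_PInf_Ex_of_nat[of "limsup (\<lambda>n. ereal (root n (x n)))"] by auto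
      then have "\<forall>\<^sub>F n in sequentially. ereal (root n (x n)) < ereal (real M)"
        by (rule Limsup_lessD)
      then obtain N where N: "\<And>n. n \<ge> N \<Longrightarrow> root n (x n) < real M"
        by (auto simp: eventually_sequentially)
      obtain n where "n > max M N" "real (max M N) < root n (x n)"
        using large by blast
      then show False
        using N[of n] by auto
    qed
  qed
  also have "\<dots> \<longleftrightarrow> (\<forall>M. \<exists>n>M. real M ^ n * fact n < norm (fl_moment n f \<alpha>))"
    using less by (metis (no_types, lifting) fact_gt_zero pos_less_divide_eq x_def)
  finally show ?thesis
    by (simp only: r)
qed

subsection \<open>Open sets and density\<close>

lemma openin_schwartz_ball:
  assumes "f \<in> schwartz_half_line m" "enat k \<le> m" "0 < e"
  shows "openin (schwartz_topology m) {g \<in> schwartz_half_line m. rho l k (\<lambda>t. g t - f t) < ereal e}"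
  unfolding schwartz_topology_def using assms by (intro topology_generated_by_Basis) blast

text \<open>Seminorms with \<open>k = 0\<close> suffice: the weights \<open>t ^ n\<close> and
  \<open>t ^ (n + 2)\<close> control the moment of the difference for all \<alpha> at once.\<close>

lemma fl_moment_neighbourhood:
  assumes f: "f \<in> schwartz_half_line m" and d: "d > 0"
  obtains W where "openin (schwartz_topology m) W" "f \<in> W"
    "\<And>g \<alpha>. g \<in> W \<Longrightarrow> norm (fl_moment n g \<alpha> - fl_moment n f \<alpha>) \<le> d"
proof
  \<comment> \<open>Two seminorms below \<open>e\<close> bound the weighted difference by
    \<open>2 * e\<close>, and integration contributes \<open>pi\<close>.\<close>
  define e where "e = d / (2 * pi)"
  have e: "e > 0"
    using d by (simp add: e_def)
  have m: "enat 0 \<le> m"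
    by (simp flip: zero_enat_def)
  let ?B = "\<lambda>l. {g \<in> schwartz_half_line m. rho l 0 (\<lambda>t. g t - f t) < ereal e}"
  show "openin (schwartz_topology m) (?B n \<inter> ?B (n + 2))"
    by (intro openin_Int openin_schwartz_ball f m e)
  show "f \<in> ?B n \<inter> ?B (n + 2)"
    using f e by (auto simp: rho_less_iff)
  fix g \<alpha> assume g: "g \<in> ?B n \<inter> ?B (n + 2)"
  have rd: "rapidly_decreasing f" "rapidly_decreasing g"
    using f g by (auto intro: schwartz_imp_rapidly_decreasing)
  have "norm (fl_moment n (\<lambda>t. 1 * g t + (-1) * f t) \<alpha>) \<le> (2 * e) * pi"
  proof (rule fl_moment_le[OF rapidly_decreasing_linear[OF rd(2,1)]])
    fix t :: real assume "t \<ge> 0"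
    then have "t ^ n * norm (g t - f t) \<le> e" "t ^ (n + 2) * norm (g t - f t) \<le> e"
      using g by (auto simp: rho_less_iff intro: order.trans less_imp_le)
    then show "(1 + t\<^sup>2) * (t ^ n * norm (1 * g t + (-1) * f t)) \<le> 2 * e"
      by (simp add: algebra_simps power_add power2_eq_square)
  qed
  then show "norm (fl_moment n g \<alpha> - fl_moment n f \<alpha>) \<le> d"
    unfolding fl_moment_linear[OF rd(2,1)] by (simp add: e_def)
qed

text \<open>A tube-lemma argument: near each \<alpha> a single order \<open>n\<close> works on a
  product \<open>V\<close> times \<open>W\<close> of neighbourhoods of \<alpha> and
  \<open>f\<close>. Finitely many \<open>V\<close> cover the compact interval, and the corresponding
  \<open>W\<close> are intersected.\<close>

lemma openin_large_derivatives:
  fixes M :: nat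
  shows "openin (schwartz_topology m) {f \<in> schwartz_half_line m.
    \<forall>\<alpha>\<in>{-real M..real M}. \<exists>n>M. real M ^ n * fact n < norm (fl_moment n f \<alpha>)}"
    (is "openin ?X ?U")
proof (subst openin_subopen, intro ballI)
  let ?P = "\<lambda>f \<alpha>. \<exists>n>M. real M ^ n * fact n < norm (fl_moment n f \<alpha>)"
  fix f assume "f \<in> ?U"
  then have f: "f \<in> schwartz_half_line m" and large: "\<And>\<alpha>. \<alpha> \<in> {-real M..real M} \<Longrightarrow> ?P f \<alpha>"
    by auto
  have "\<exists>V W. open V \<and> \<alpha> \<in> V \<and> openin ?X W \<and> f \<in> W \<and> (\<forall>\<beta>\<in>V. \<forall>g\<in>W. ?P g \<beta>)"
    if \<alpha>: "\<alpha> \<in> {-real M..real M}" for \<alpha>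
  proof -
    obtain n where n: "n > M" "real M ^ n * fact n < norm (fl_moment n f \<alpha>)"
      using large[OF \<alpha>] by blast
    \<comment> \<open>Half of the excess: one half is spent on moving \<alpha>, the other on moving
      \<open>f\<close>.\<close>
    define d where "d = (norm (fl_moment n f \<alpha>) - real M ^ n * fact n) / 2"
    have d: "d > 0"
      using n by (simp add: d_def)
    obtain W where W: "openin ?X W" "f \<in> W"
      "\<And>g \<alpha>. g \<in> W \<Longrightarrow> norm (fl_moment n g \<alpha> - fl_moment n f \<alpha>) \<le> d"
      by (rule fl_moment_neighbourhood[OF f d]) blast
    define V where "V = {\<beta>. norm (fl_moment n f \<alpha>) - d < norm (fl_moment n f \<beta>)}"
    have "open V"
      unfolding V_def
      using continuous_on_fl_moment[OF schwartz_imp_rapidly_decreasing[OF f]]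
      by (intro open_Collect_less continuous_intros)
    moreover have "?P g \<beta>" if "\<beta> \<in> V" "g \<in> W" for \<beta> g
    proof -
      have "norm (fl_moment n f \<beta>) \<le> norm (fl_moment n g \<beta>) + d"
        using W(3)[OF that(2), of \<beta>] norm_triangle_sub[of "fl_moment n f \<beta>" "fl_moment n g \<beta>"]
        by (simp add: norm_minus_commute)
      then have "real M ^ n * fact n < norm (fl_moment n g \<beta>)"
        using that(1) by (simp add: V_def d_def field_simps)
      then show ?thesis
        using n(1) by blast
    qed
    moreover have "\<alpha> \<in> V"
      using d by (simp add: V_def)
    ultimately show ?thesis
      using W(1,2) by blast
  qed
  then obtain V W where VW: "\<And>\<alpha>. \<alpha> \<in> {-real M..real M} \<Longrightarrow> open (V \<alpha>) \<and> \<alpha> \<in> V \<alpha> \<and> openin ?X (W \<alpha>) \<and>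
      f \<in> W \<alpha> \<and> (\<forall>\<beta>\<in>V \<alpha>. \<forall>g\<in>W \<alpha>. ?P g \<beta>)"
    by metis
  obtain C where C: "C \<subseteq> {-real M..real M}" "finite C" "{-real M..real M} \<subseteq> (\<Union>\<alpha>\<in>C. V \<alpha>)"
  proof (rule compactE_image[of "{-real M..real M}" "{-real M..real M}" V])
    show "compact {- real M..real M}"
      by (rule compact_Icc)
  qed (use VW in blast)+
  show "\<exists>T. openin ?X T \<and> f \<in> T \<and> T \<subseteq> ?U"
  proof (intro exI conjI)
    show "openin ?X ((\<Inter>\<alpha>\<in>C. W \<alpha>) \<inter> topspace ?X)"
      using C(1,2) VW by (intro openin_INT) auto
    show "f \<in> (\<Inter>\<alpha>\<in>C. W \<alpha>) \<inter> topspace ?X"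
      using C(1) VW f by (auto simp: topspace_schwartz_topology)
    show "(\<Inter>\<alpha>\<in>C. W \<alpha>) \<inter> topspace ?X \<subseteq> ?U"
    proof
      fix g assume g: "g \<in> (\<Inter>\<alpha>\<in>C. W \<alpha>) \<inter> topspace ?X"
      have "?P g \<beta>" if \<beta>: "\<beta> \<in> {-real M..real M}" for \<beta>
      proof -
        obtain \<alpha> where "\<alpha> \<in> C" "\<beta> \<in> V \<alpha>"
          using C(3) \<beta> by blast
        moreover have "g \<in> W \<alpha>" "\<alpha> \<in> {-real M..real M}"
          using \<open>\<alpha> \<in> C\<close> g C(1) by auto
        ultimately show ?thesis
          using VW by blast
      qed
      then show "g \<in> ?U"
        using g by (simp add: topspace_schwartz_topology)
    qed
  qed
qed

section \<open>Perturbation by small multiples of a fixed smooth function\<close>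

locale smooth_decreasing =
  fixes H :: "nat \<Rightarrow> real \<Rightarrow> real"
  assumes H: "\<And>k t. (H k has_real_derivative H (Suc k) t) (at t)"
    and decay: "\<And>k l. \<exists>B. \<forall>t\<ge>0. t ^ l * \<bar>H k t\<bar> \<le> B"
begin

text \<open>The restriction restores the value \<open>undefined\<close> at negative arguments,
  without which the sum would not belong to the space.\<close>

definition perturb :: "(real \<Rightarrow> complex) \<Rightarrow> real \<Rightarrow> real \<Rightarrow> complex" where
  "perturb f \<epsilon> = restrict (\<lambda>t. f t + of_real \<epsilon> * of_real (H 0 t)) {0..}"

lemma perturb_eq: "t \<ge> 0 \<Longrightarrow> perturb f \<epsilon> t = 1 * f t + of_real \<epsilon> * of_real (H 0 t)"
  by (simp add: perturb_def)

lemma iter_deriv_perturb: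
  assumes u: "C_half_line m u" and k: "enat k \<le> m" "t \<ge> 0"
  shows "iter_deriv {0..} k (\<lambda>t. u t + of_real \<epsilon> * of_real (H 0 t)) t = iter_deriv {0..} k u t + of_real \<epsilon> * of_real (H k t)"
  using iter_deriv_linear[OF u C_half_line_smooth[of H, OF H] k, of 1 "of_real \<epsilon>"]
    iter_deriv_smooth[of H, OF H k(2)] by simp

text \<open>Applied to \<open>u = f\<close> for membership in the space, and to the difference of
  \<open>f\<close> and the centre of a seminorm ball for closeness.\<close>

lemma norm_iter_deriv_perturb:
  assumes "C_half_line m u" "enat k \<le> m" "t \<ge> 0"
    and "t ^ l * norm (iter_deriv {0..} k u t) \<le> r" "t ^ l * \<bar>H k t\<bar> \<le> B" "\<epsilon> \<ge> 0"
  shows "t ^ l * norm (iter_deriv {0..} k (\<lambda>t. u t + of_real \<epsilon> * of_real (H 0 t)) t) \<le> r + \<epsilon> * B"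
proof -
  have "t ^ l * norm (iter_deriv {0..} k (\<lambda>t. u t + of_real \<epsilon> * of_real (H 0 t)) t) \<le>
      t ^ l * (norm (iter_deriv {0..} k u t) + \<epsilon> * \<bar>H k t\<bar>)"
    unfolding iter_deriv_perturb[OF assms(1-3)] using assms(3,6)
    by (intro mult_left_mono order.trans[OF norm_triangle_ineq]) (auto simp: norm_mult)
  also have "\<dots> = t ^ l * norm (iter_deriv {0..} k u t) + \<epsilon> * (t ^ l * \<bar>H k t\<bar>)"
    by (simp add: algebra_simps)
  also have "\<dots> \<le> r + \<epsilon> * B"
    using assms by (intro add_mono mult_left_mono) auto
  finally show ?thesis .
qed

lemma perturb_in_schwartz:
  assumes f: "f \<in> schwartz_half_line m" and \<epsilon>: "\<epsilon> \<ge> 0"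
  shows "perturb f \<epsilon> \<in> schwartz_half_line m"
proof -
  have Cf: "C_half_line m f"
    using f by (simp add: schwartz_half_line_def)
  have "C_half_line m (perturb f \<epsilon>)"
    using C_half_line_linear[OF Cf C_half_line_smooth[of H, OF H], of 1 "of_real \<epsilon>"]
    by (subst C_half_line_cong[OF perturb_eq])
  moreover have "rho l k (perturb f \<epsilon>) < \<infinity>" if k: "enat k \<le> m" for l k
  proof -
    have "rho l k f < \<infinity>"
      using f k by (simp add: schwartz_half_line_def)
    then obtain r B where rB: "\<forall>t\<ge>0. t ^ l * norm (iter_deriv {0..} k f t) \<le> r"
      "\<forall>t\<ge>0. t ^ l * \<bar>H k t\<bar> \<le> B"
      using decay by (metis rho_less_top_iff)
    have "t ^ l * norm (iter_deriv {0..} k (perturb f \<epsilon>) t) \<le> r + \<epsilon> * B" if t: "t \<ge> 0" for t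
      using norm_iter_deriv_perturb[OF Cf k t _ _ \<epsilon>] rB t
        iter_deriv_cong[of "{0..}" "perturb f \<epsilon>" "\<lambda>t. f t + of_real \<epsilon> * of_real (H 0 t)" t k]
      by (simp add: perturb_def)
    then show ?thesis
      unfolding rho_less_top_iff by blast
  qed
  ultimately show ?thesis
    by (simp add: schwartz_half_line_def perturb_def)
qed

text \<open>Continuity of the perturbation at \<epsilon> = 0, by induction on the generation of the
  open set. For a seminorm ball around some other centre \<open>f0\<close>, the bound
  \<open>r < e\<close> becomes \<open>r + \<epsilon> * B\<close>, which stays below \<open>e\<close>
  for small \<epsilon>.\<close>

lemma eventually_perturb_in_open:
  assumes "openin (schwartz_topology m) U" "f \<in> U"
  shows "\<forall>\<^sub>F \<epsilon> in at_right 0. perturb f \<epsilon> \<in> U"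
proof -
  have "f \<in> U \<Longrightarrow> \<forall>\<^sub>F \<epsilon> in at_right 0. perturb f \<epsilon> \<in> U"
    using assms(1)[unfolded schwartz_topology_def openin_topology_generated_by_iff]
  proof (induction U rule: generate_topology_on.induct)
    case (Int a b)
    then show ?case
      by (simp add: eventually_conj)
  next
    case (UN K)
    then obtain k where "k \<in> K" "\<forall>\<^sub>F \<epsilon> in at_right 0. perturb f \<epsilon> \<in> k"
      by blast
    then show ?case
      by (auto elim: eventually_mono)
  next
    case (Basis s)
    then obtain f0 l k e where s: "s = {g \<in> schwartz_half_line m. rho l k (\<lambda>t. g t - f0 t) < ereal e}"
      and f0: "f0 \<in> schwartz_half_line m" and k: "enat k \<le> m"
      by blast
    have f: "f \<in> schwartz_half_line m" and "rho l k (\<lambda>t. f t - f0 t) < ereal e"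
      using Basis.prems s by auto
    then obtain r where r: "r < e" "\<forall>t\<ge>0. t ^ l * norm (iter_deriv {0..} k (\<lambda>t. f t - f0 t) t) \<le> r"
      by (auto simp: rho_less_iff)
    obtain B where B: "\<forall>t\<ge>0. t ^ l * \<bar>H k t\<bar> \<le> B"
      using decay by blast
    have Cd: "C_half_line m (\<lambda>t. f t - f0 t)"
      using C_half_line_linear[of m f f0 1 "-1"] f f0 by (simp add: schwartz_half_line_def)
    have "((\<lambda>\<epsilon>. r + \<epsilon> * B) \<longlongrightarrow> r + 0 * B) (at_right 0)"
      by (intro tendsto_intros)
    then have "\<forall>\<^sub>F \<epsilon> in at_right 0. r + \<epsilon> * B < e"
      using r(1) by (intro order_tendstoD(2)) auto
    moreover have "\<forall>\<^sub>F \<epsilon> in at_right 0. (0 :: real) < \<epsilon>"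
      by (rule eventually_at_right_less)
    ultimately show ?case
    proof eventually_elim
      case (elim \<epsilon>)
      have "t ^ l * norm (iter_deriv {0..} k (\<lambda>t. perturb f \<epsilon> t - f0 t) t) \<le> r + \<epsilon> * B" if t: "t \<ge> 0" for t
        using norm_iter_deriv_perturb[OF Cd k t, of l r B \<epsilon>] r(2) B elim t
          iter_deriv_cong[of "{0..}" "\<lambda>t. perturb f \<epsilon> t - f0 t" "\<lambda>t. f t - f0 t + of_real \<epsilon> * of_real (H 0 t)" t k]
        by (simp add: perturb_def)
      then have "rho l k (\<lambda>t. perturb f \<epsilon> t - f0 t) < ereal e"
        using elim(1) unfolding rho_less_iff by blast
      then show ?case
        using perturb_in_schwartz[OF f] elim(2) s by simp
    qed
  qed auto
  with assms(2) show ?thesis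
    by blast
qed

end

text \<open>The order of choices matters: \<open>f\<close> determines the thresholds
  \<open>A\<close> and these determine \<open>H\<close>; only then is \<epsilon> taken small enough
  to stay in \<open>U\<close>. So \<open>H\<close> must work for every \<epsilon> > 0.\<close>

lemma r_inv_infinite_intersects_open:
  assumes U: "openin (schwartz_topology m) U" and f: "f \<in> U"
  obtains g where "g \<in> U" "g \<in> schwartz_half_line m" "\<And>\<alpha>. r_inv g \<alpha> = \<infinity>"
proof -
  have fS: "f \<in> schwartz_half_line m"
    using openin_subset[OF U] f by (auto simp: topspace_schwartz_topology)
  have rdf: "rapidly_decreasing f"
    by (rule schwartz_imp_rapidly_decreasing[OF fS])
  have "\<exists>B. \<forall>\<alpha>. norm (fl_moment n f \<alpha>) \<le> B" for n
    using weighted_bound[OF rdf, of n] fl_moment_le[OF rdf, of n] by metis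
  then obtain B where B: "\<And>n \<alpha>. norm (fl_moment n f \<alpha>) \<le> B n"
    by metis
  \<comment> \<open>\<open>B\<close> offsets the contribution of \<open>f\<close>, the middle term
    is the growth to be exceeded, and 1 makes the inequality strict. The leading
    \<open>real (Suc i)\<close> compensates for \<epsilon>, unknown at this point, once
    \<open>i + 1 \<ge> 1 / \<epsilon>\<close>.\<close>
  define A where "A = (\<lambda>i. real (Suc i) * (B (4 * i + 4) + real (Suc i) ^ (4 * i + 4) * fact (4 * i + 4) + 1))"
  obtain H where H_props: "\<And>k t. (H k has_real_derivative H (Suc k) t) (at t)"
    "\<And>k l. \<exists>B. \<forall>t\<ge>0. t ^ l * \<bar>H k t\<bar> \<le> B"
    "\<And>i \<alpha>. \<bar>\<alpha>\<bar> \<le> real (Suc i) \<Longrightarrow> A i \<le> norm (fl_moment (4 * i + 4) (\<lambda>t. of_real (H 0 t)) \<alpha>)"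
    by (rule large_moments[of A]) blast
  interpret smooth_decreasing H
    by standard (use H_props in auto)
  have rdH: "rapidly_decreasing (\<lambda>t. of_real (H 0 t))"
    using H_props(2) DERIV_isCont[OF H_props(1)] by (intro rapidly_decreasing_of_real) auto
  have "\<forall>\<^sub>F \<epsilon> in at_right 0. 0 < \<epsilon> \<and> perturb f \<epsilon> \<in> U"
    using eventually_perturb_in_open[OF U f] by (simp add: eventually_conj_iff eventually_at_right_less)
  then obtain \<epsilon> where \<epsilon>: "0 < \<epsilon>" "perturb f \<epsilon> \<in> U"
    using eventually_happens'[OF trivial_limit_at_right_real] by blast
  have g: "perturb f \<epsilon> \<in> schwartz_half_line m"
    using perturb_in_schwartz[OF fS] \<epsilon>(1) by simp
  have "r_inv (perturb f \<epsilon>) \<alpha> = \<infinity>" for \<alpha>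
    unfolding r_inv_eq_infinity_iff[OF schwartz_imp_rapidly_decreasing[OF g]]
  proof
    fix M :: nat
    \<comment> \<open>A bump is needed whose growth rate exceeds \<open>M\<close>, whose range of
      frequencies contains \<alpha>, and whose index compensates for \<epsilon>.\<close>
    obtain i where i: "real i \<ge> max (real M) (max \<bar>\<alpha>\<bar> (1 / \<epsilon>))"
      using real_arch_simple by blast
    define n where "n = 4 * i + 4"
    define X where "X = B n + real (Suc i) ^ n * fact n + 1"
    have "B n \<ge> 0"
      using B[of n 0] norm_ge_zero order.trans by blast
    then have "X \<ge> 0"
      by (simp add: X_def)
    have "1 / \<epsilon> \<le> real (Suc i)"
      using i by simp
    then have "1 \<le> \<epsilon> * real (Suc i)"
      using \<epsilon>(1) by (simp add: field_simps)
    then have "X \<le> \<epsilon> * A i"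
      using \<open>X \<ge> 0\<close> mult_right_mono[of 1 "\<epsilon> * real (Suc i)" X]
      by (simp add: A_def X_def n_def mult.assoc)
    also have "\<dots> \<le> \<epsilon> * norm (fl_moment n (\<lambda>t. of_real (H 0 t)) \<alpha>)"
      using H_props(3)[of \<alpha> i] i \<epsilon>(1) by (simp add: n_def)
    also have "\<dots> = norm (fl_moment n (perturb f \<epsilon>) \<alpha> - fl_moment n f \<alpha>)"
      using \<epsilon>(1) by (simp only: fl_moment_cong[OF perturb_eq] fl_moment_linear[OF rdf rdH])
        (simp add: norm_mult)
    also have "\<dots> \<le> norm (fl_moment n (perturb f \<epsilon>) \<alpha>) + B n"
      using B[of n \<alpha>] norm_triangle_ineq4[of "fl_moment n (perturb f \<epsilon>) \<alpha>" "fl_moment n f \<alpha>"] by linarith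
    finally have "real (Suc i) ^ n * fact n < norm (fl_moment n (perturb f \<epsilon>) \<alpha>)"
      by (simp add: X_def)
    moreover have "real M ^ n * fact n \<le> real (Suc i) ^ n * fact n"
      using i by (intro mult_right_mono power_mono) auto
    moreover have "n > M"
      using i by (simp add: n_def)
    ultimately show "\<exists>n>M. real M ^ n * fact n < norm (fl_moment n (perturb f \<epsilon>) \<alpha>)"
      by (meson le_less_trans)
  qed
  with \<epsilon>(2) g show ?thesis
    by (rule that)
qed

theorem theorem2:
  fixes m :: enat
  shows "schwartz_topology m closure_of
           {f \<in> schwartz_half_line m. \<forall>\<alpha>::real. r_inv f \<alpha> = \<infinity>} =
           topspace (schwartz_topology m) \<and>
         gdelta_in (schwartz_topology m)
           {f \<in> schwartz_half_line m. \<forall>\<alpha>::real. r_inv f \<alpha> = \<infinity>}"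
    (is "?X closure_of ?E = _ \<and> _")
proof
  show "?X closure_of ?E = topspace ?X"
    unfolding dense_intersects_open using r_inv_infinite_intersects_open by blast
  let ?U = "\<lambda>M. {f \<in> schwartz_half_line m.
    \<forall>\<alpha>\<in>{-real M..real M}. \<exists>n>M. real M ^ n * fact n < norm (fl_moment n f \<alpha>)}"
  have "?E = (\<Inter>M. ?U M)"
  proof (intro equalityI subsetI)
    fix f assume "f \<in> ?E"
    then show "f \<in> (\<Inter>M. ?U M)"
      by (auto simp: r_inv_eq_infinity_iff schwartz_imp_rapidly_decreasing)
  next
    fix f assume f: "f \<in> (\<Inter>M. ?U M)"
    have "\<exists>n>M. real M ^ n * fact n < norm (fl_moment n f \<alpha>)" for M \<alpha>
    proof -
      \<comment> \<open>The \<open>M\<close>-th set only controls \<alpha> in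
        \<open>[-M, M]\<close>; since the condition gets stronger with \<open>M\<close>, a larger
        index \<open>N\<close> covering \<alpha> can be used instead.\<close>
      obtain N :: nat where N: "real N \<ge> max (real M) \<bar>\<alpha>\<bar>"
        using real_arch_simple by blast
      then have "\<alpha> \<in> {-real N..real N}" "M \<le> N"
        by auto
      then obtain n where "n > N" "real N ^ n * fact n < norm (fl_moment n f \<alpha>)"
        using f by blast
      moreover have "real M ^ n * fact n \<le> real N ^ n * fact n"
        using \<open>M \<le> N\<close> by (intro mult_right_mono power_mono) auto
      ultimately show ?thesis
        using \<open>M \<le> N\<close> by (meson le_less_trans)
    qed
    then show "f \<in> ?E"
      using f by (auto simp: r_inv_eq_infinity_iff schwartz_imp_rapidly_decreasing)
  qed
  then show "gdelta_in ?X ?E"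
    by (simp only:) (intro gdelta_in_Inter; auto intro!: open_imp_gdelta_in openin_large_derivatives)
qed

end
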